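(* Let $\mathcal L(z)=\frac12(\|z^X\|^2-\|z^Y\|^2)-\Psi(z)$ on the Hilbert space $\mathcal H=X\oplus Y$, where $\Psi\in C^2(\mathcal H,\mathbb R)$ satisfies the hypotheses (H1)–(H5) listed in the context. If there exists a sequence $\{z_n\}\subset\mathcal H$ and constants $c_1,c_2>0$ such that \[ c_1\le\mathcal L(z_n)\le c_2\quad\text{and}\quad \|\nabla\mathcal L(z_n)\|\to0\ \text{ as } n\to\infty, \] then the min-max value $\gamma>0$ defined in the context satisfies \[ \gamma\le\mathcal L(z_n)+O\big(\|\nabla\mathcal L(z_n)\|^2\big)\quad\text{as } n\to\infty . \] If, additionally, the functional $\mathcal L$ satisfies the Palais–Smale condition at the energy level $\gamma$ (every sequence $\{u_n\}\subset\mathcal H$ with $\mathcal L(u_n)\to\gamma$ and $\nabla\mathcal L(u_n)\to0$ has a strongly convergent subsequence), then there exists $z\in\mathcal H\setminus\{0\}$ such that $\mathcal L(z)=\gamma$ and $\nabla\mathcal L(z)=0$.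
   Context: Setting: $\mathcal H$ is a real Hilbert space with scalar product $\langle\cdot,\cdot\rangle$ and norm $\|\cdot\|$, $\mathcal H=X\oplus Y$ with $X,Y$ infinite-dimensional (closed) orthogonal subspaces; $z^X,z^Y$ denote the orthogonal projections of $z\in\mathcal H$ to $X,Y$. $|||\cdot|||$ is the operator norm of bounded linear operators; $\nabla,\nabla^2$ denote gradient and second derivative with respect to $\langle\cdot,\cdot\rangle$. The hypotheses on $\Psi\in C^2(\mathcal H,\mathbb R)$ are: (H1) There is a continuous function $\varrho:[0,\infty)\to[0,\infty)$ such that $|||\nabla^2\Psi(z)|||\le\varrho(\|z\|)$ for all $z\in\mathcal H$. (H2) $\Psi(0)=0$ and there exists $p>2$ such that $\langle\nabla\Psi(z),z\rangle\ge p\,\Psi(z)$ for all $z\in\mathcal H$. (H3) $\Psi\not\equiv0$ on $\mathcal H$ and $\Psi$ is convex. (H4) There exist $K>0$ and $\mu\in(\frac12,1)$ such that $\|\nabla\Psi(z)\|\le K\langle\nabla\Psi(z),z\rangle^\mu+\mu\|z\|$ for all $z\in\mathcal H$. (H5) There exists $\kappa>1$ such that for all $z,w\in\mathcal H$: $\langle\nabla^2\Psi(z)[z+w],z+w\rangle-2\langle\nabla\Psi(z),w\rangle\ge\kappa\langle\nabla\Psi(z),z\rangle$. Under these hypotheses, for each $\varphi\in X$ the functional $w\mapsto\mathcal L(\varphi+w)$ on $Y$ has a unique maximizer $\beta(\varphi)\in Y$, and $\beta\in C^1(X,Y)$. The reduced functional is $\mathcal J:X\to\mathbb R$, $\mathcal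 J(\varphi)=\mathcal L(\varphi+\beta(\varphi))$, and $\mathcal N=\{\varphi\in X\setminus\{0\}:\langle\nabla\mathcal J(\varphi),\varphi\rangle=0\}$. With $\mathbb R^+=(0,\infty)$ the min-max value is \[ \gamma=\inf_{\varphi\in X\setminus\{0\}}\max_{t>0}\mathcal J(t\varphi)=\inf_{\varphi\in X\setminus\{0\}}\max_{z\in\mathbb R^+\varphi\oplus Y}\mathcal L(z)=\inf_{\varphi\in\mathcal N}\mathcal J(\varphi), \] where a maximum that is not attained is read as a supremum in $(0,+\infty]$. *)

theory Defs
  imports "HOL-Analysis.Analysis" "HOL-Library.Landau_Symbols"
begin

definition infinite_dimensional :: "'a::real_vector set \<Rightarrow> bool" where
  "infinite_dimensional S \<longleftrightarrow> (\<nexists>B. finite B \<and> span B = S)"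

definition orth_proj :: "'a::real_inner set \<Rightarrow> 'a \<Rightarrow> 'a" where
  "orth_proj S z = (THE x. x \<in> S \<and> (\<forall>w\<in>S. orthogonal (z - x) w))"

text \<open>Continuous differentiability in the sense of Frechet, on the whole space; the derivative
  is continuous with respect to the operator norm (the norm of the type of bounded linear maps).\<close>

definition C1 :: "('a::real_normed_vector \<Rightarrow> 'b::real_normed_vector) \<Rightarrow> bool" where
  "C1 f \<longleftrightarrow> (\<exists>D :: 'a \<Rightarrow> 'a \<Rightarrow>\<^sub>L 'b.
     (\<forall>z. (f has_derivative blinfun_apply (D z)) (at z)) \<and> continuous_on UNIV D)"

definition C2 :: "('a::real_normed_vector \<Rightarrow> 'b::real_normed_vector) \<Rightarrow> bool" where
  "C2 f \<longleftrightarrow> (\<exists>D :: 'a \<Rightarrow> 'a \<Rightarrow>\<^sub>L 'b.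
     (\<forall>z. (f has_derivative blinfun_apply (D z)) (at z)) \<and> C1 D)"

definition grad :: "('a::real_inner \<Rightarrow> real) \<Rightarrow> 'a \<Rightarrow> 'a" where
  "grad f z = (THE v. GDERIV f z :> v)"

text \<open>The second derivative with respect to the scalar product, as a bounded operator.\<close>

definition hess :: "('a::real_inner \<Rightarrow> real) \<Rightarrow> 'a \<Rightarrow> 'a \<Rightarrow>\<^sub>L 'a" where
  "hess f z = (THE A. (grad f has_derivative blinfun_apply A) (at z))"

definition energy :: "'a::real_inner set \<Rightarrow> 'a set \<Rightarrow> ('a \<Rightarrow> real) \<Rightarrow> 'a \<Rightarrow> real" where
  "energy X Y \<Psi> z = ((norm (orth_proj X z))\<^sup>2 - (norm (orth_proj Y z))\<^sup>2) / 2 - \<Psi> z"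

definition maximizer :: "'a::real_inner set \<Rightarrow> ('a \<Rightarrow> real) \<Rightarrow> 'a \<Rightarrow> 'a" where
  "maximizer Y L \<phi> = (THE w. w \<in> Y \<and> (\<forall>v\<in>Y. L (\<phi> + v) \<le> L (\<phi> + w)))"

definition reduced :: "'a::real_inner set \<Rightarrow> ('a \<Rightarrow> real) \<Rightarrow> 'a \<Rightarrow> real" where
  "reduced Y L \<phi> = L (\<phi> + maximizer Y L \<phi>)"

text \<open>The min-max value is an extended real because the inner maximum need not be attained and
  is then read as a supremum, possibly infinite.\<close>

definition minmax :: "'a::real_inner set \<Rightarrow> 'a set \<Rightarrow> ('a \<Rightarrow> real) \<Rightarrow> ereal" where
  "minmax X Y L = (INF \<phi>\<in>X - {0}. SUP t\<in>{0<..}. ereal (reduced Y L (t *\<^sub>R \<phi>)))"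

definition palais_smale_at :: "('a::real_inner \<Rightarrow> real) \<Rightarrow> ereal \<Rightarrow> bool" where
  "palais_smale_at L c \<longleftrightarrow>
     (\<forall>u :: nat \<Rightarrow> 'a. (\<lambda>n. ereal (L (u n))) \<longlonglongrightarrow> c \<longrightarrow> (\<lambda>n. grad L (u n)) \<longlonglongrightarrow> 0 \<longrightarrow>
        (\<exists>r l. strict_mono r \<and> (u \<circ> r) \<longlonglongrightarrow> l))"

end

theory Submission imports Defs begin

text \<open>
  The mechanism is a change of variables that makes the functional concave. Fix \<open>a\<close> in the whole
  space and \<open>b\<close> in \<open>Y\<close>, and follow the curve \<open>sqrt r a + b / sqrt r\<close> for \<open>r > 0\<close>. Its acceleration
  is exactly the one for which the first-order terms produced by hypothesis H5 cancel: along it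
  the second derivative of \<open>L\<close> in \<open>r\<close> is at most
  \<open>- (4 |b|^2 / r + (\<kappa> - 1) q) / (4 r^2)\<close>, where \<open>q = \<langle>\<nabla>\<Psi>(z), z\<rangle> \<ge> 0\<close> at the current point \<open>z\<close>.
  Any point \<open>z\<close> is joined by such a curve to every point \<open>t z^X + w\<close> with \<open>t > 0\<close>, \<open>t \<noteq> 1\<close>
  and \<open>w\<close> in \<open>Y\<close>.

  Hence a point \<open>z\<close> at which the gradient is small on the span of \<open>z\<close> and \<open>Y\<close>, say of size \<open>e\<close>,
  almost maximizes \<open>L\<close> on the half space \<open>{t z^X + w}\<close>. The starting slope of the curve is
  at most \<open>e (1 + |b|)\<close>, while near \<open>z\<close> the concavity is of order \<open>(1 + |b|)^2\<close>, because
  \<open>q\<close> stays bounded below when \<open>L z \<ge> c > 0\<close>; a concave function can then gain at most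
  \<open>O(e^2)\<close>. This is \<open>almost_maximal\<close>. It gives the estimate of the min-max value as soon as the
  sequence is known to be bounded, which follows from H2 and H4.

  For the critical point a Palais--Smale sequence at the min-max level \<open>\<gamma>\<close> is needed. Take a half
  space on which the supremum of \<open>L\<close> is at most \<open>\<gamma> + s^2\<close>, and in it a point \<open>z\<close> with
  \<open>L z \<ge> \<gamma> - s^2\<close>. By H4 such a \<open>z\<close> can be chosen in a ball that does not depend on \<open>s\<close>
  (\<open>near_minmax_point\<close>), and there the gradient \<open>G\<close> of \<open>L\<close> at \<open>z\<close> is \<open>O(s)\<close> on the
  span of \<open>z\<close> and \<open>Y\<close>. The displaced point \<open>z - s G\<close> still has this property, so
  \<open>almost_maximal\<close> applies to it and gives
  \<open>\<gamma> \<le> L (z - s G) + O(s^2) \<le> \<gamma> - s |G|^2 + O(s^2)\<close>, that is, \<open>|G|^2 = O(s)\<close>.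
\<close>

section \<open>Maximization of strongly concave functions and the Riesz representation\<close>

text \<open>
  Completeness replaces compactness: strong concavity at midpoints bounds the distance of two
  almost maximizers by their defects, so every maximizing sequence is Cauchy. The constant \<open>1/8\<close>
  is the one of \<open>- |x|^2 / 2\<close>, to which both applications below reduce.
\<close>

lemma strongly_midpoint_concave_has_maximizer:
  fixes F :: "'a::{real_inner, banach} \<Rightarrow> real"
  assumes C: "subspace C" "closed C"
    and cont: "continuous_on UNIV F"
    and bdd: "\<And>x. x \<in> C \<Longrightarrow> F x \<le> B"
    and mid: "\<And>a b. a \<in> C \<Longrightarrow> b \<in> C \<Longrightarrow>
       F ((1/2) *\<^sub>R (a + b)) \<ge> (F a + F b) / 2 + (norm (a - b))\<^sup>2 / 8"
  shows "\<exists>!x. x \<in> C \<and> (\<forall>y\<in>C. F y \<le> F x)"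
proof -
  define m where "m = (SUP x\<in>C. F x)"
  have ne: "C \<noteq> {}" using C(1) subspace_0 by auto
  have bdd': "bdd_above (F ` C)" by (rule bdd_aboveI2[of _ _ B]) (rule bdd)
  have le: "F x \<le> m" if "x \<in> C" for x
    unfolding m_def using bdd' that by (rule cSUP_upper2) simp
  have "\<exists>x\<in>C. F x > m - 1 / real (Suc n)" for n
  proof -
    have "m - 1 / real (Suc n) < (SUP x\<in>C. F x)" unfolding m_def by simp
    then show ?thesis using less_cSUP_iff[OF ne bdd'] by blast
  qed
  then obtain x where x: "\<And>n. x n \<in> C" "\<And>n. F (x n) > m - 1 / real (Suc n)" by metis
  have mC: "(1/2) *\<^sub>R (a + b) \<in> C" if "a \<in> C" "b \<in> C" for a b
    using C(1) that by (simp add: subspace_add subspace_scale)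
  have close: "(norm (a - b))\<^sup>2 \<le> 8 * s" if "a \<in> C" "b \<in> C" "F a \<ge> m - s" "F b \<ge> m - s" for a b s
    using mid[OF that(1,2)] le[OF mC[OF that(1,2)]] that(3,4) by (simp add: field_simps)
  have "Cauchy x"
  proof (rule metric_CauchyI)
    fix e :: real assume "e > 0"
    then have "e\<^sup>2 / 8 > 0" by simp
    then obtain N where N: "1 / real (Suc N) < e\<^sup>2 / 8"
      using nat_approx_posE by metis
    have "dist (x i) (x j) < e" if ij: "i \<ge> N" "j \<ge> N" for i j
    proof -
      have "1 / real (Suc i) \<le> 1 / real (Suc N)" "1 / real (Suc j) \<le> 1 / real (Suc N)"
        using ij by (auto intro!: divide_left_mono)
      then have "(norm (x i - x j))\<^sup>2 \<le> 8 * (1 / real (Suc N))"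
        using x(2)[of i] x(2)[of j] by (intro close) (use x(1) in \<open>auto simp: less_imp_le\<close>)
      also have "\<dots> < e\<^sup>2" using N by linarith
      finally show ?thesis using \<open>e > 0\<close>
        by (simp add: dist_norm power2_less_imp_less)
    qed
    then show "\<exists>M. \<forall>i\<ge>M. \<forall>j\<ge>M. dist (x i) (x j) < e" by blast
  qed
  then obtain l where l: "x \<longlonglongrightarrow> l" using Cauchy_convergent convergentD by blast
  have lC: "l \<in> C" using C(2) l x(1) closed_sequentially by blast
  have "(\<lambda>n. F (x n)) \<longlonglongrightarrow> F l"
    using continuous_on_tendsto_compose[OF cont l] by simp
  moreover have "(\<lambda>n. m - 1 / real (Suc n)) \<longlonglongrightarrow> m - 0"
    by (intro tendsto_intros LIMSEQ_Suc[OF lim_1_over_n])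
  ultimately have "m - 0 \<le> F l"
    by (rule_tac LIMSEQ_le) (use x(2) less_imp_le in blast)+
  then have lm: "F l = m" using le[OF lC] by simp
  show ?thesis
  proof (rule ex1I[of _ l])
    show "l \<in> C \<and> (\<forall>y\<in>C. F y \<le> F l)" using lC lm le by auto
    fix y assume y: "y \<in> C \<and> (\<forall>x\<in>C. F x \<le> F y)"
    then have "(norm (y - l))\<^sup>2 \<le> 8 * 0"
      using lC lm le by (intro close) auto
    then show "y = l" by simp
  qed
qed

lemma parallelogram_midpoint:
  fixes a b :: "'a::real_inner"
  shows "(norm ((1/2) *\<^sub>R (a + b)))\<^sup>2 = ((norm a)\<^sup>2 + (norm b)\<^sup>2) / 2 - (norm (a - b))\<^sup>2 / 4"
  unfolding power2_norm_eq_inner by (simp add: inner_simps inner_commute field_simps)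

text \<open>
  The representing vector is the maximizer of \<open>f x - |x|^2 / 2\<close>. The representation is what makes
  the gradient and the second derivative as an operator well defined.
\<close>

lemma riesz_representation:
  fixes f :: "'a::{real_inner, banach} \<Rightarrow>\<^sub>L real"
  shows "\<exists>v. \<forall>h. blinfun_apply f h = inner h v"
proof -
  define F where "F x = blinfun_apply f x - (norm x)\<^sup>2 / 2" for x
  have "\<exists>!x. x \<in> UNIV \<and> (\<forall>y\<in>UNIV. F y \<le> F x)"
  proof (rule strongly_midpoint_concave_has_maximizer)
    show "continuous_on UNIV F"
      unfolding F_def by (intro continuous_intros) auto
    show "F x \<le> (norm f)\<^sup>2 / 2" for x
    proof -
      have "blinfun_apply f x \<le> norm f * norm x"
        using norm_blinfun[of f x] by simp
      also have "\<dots> \<le> (norm f)\<^sup>2 / 2 + (norm x)\<^sup>2 / 2"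
        using sum_squares_bound[of "norm f" "norm x"] by simp
      finally show ?thesis by (simp add: F_def)
    qed
    show "F ((1/2) *\<^sub>R (a + b)) \<ge> (F a + F b) / 2 + (norm (a - b))\<^sup>2 / 8" for a b
      unfolding F_def parallelogram_midpoint
      by (simp add: blinfun.add_right blinfun.scaleR_right field_simps)
  qed auto
  then obtain v where v: "\<And>y. F y \<le> F v" by blast
  have "blinfun_apply f h = inner h v" for h
  proof -
    have "F (v + t *\<^sub>R h) = F v + t * (blinfun_apply f h - inner h v) - t\<^sup>2 * (inner h h / 2)" for t
      unfolding F_def power2_norm_eq_inner
      by (simp add: inner_add_left inner_add_right inner_commute blinfun.add_right
          blinfun.scaleR_right power2_eq_square field_simps)
    then have "((\<lambda>t. F (v + t *\<^sub>R h)) has_real_derivative blinfun_apply f h - inner h v) (at 0)"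
      by (auto intro!: derivative_eq_intros)
    then have "blinfun_apply f h - inner h v = 0"
      by (rule DERIV_local_max[where d = 1]) (use v in auto)
    then show ?thesis by simp
  qed
  then show ?thesis by blast
qed

lemma inner_left_eqI:
  fixes u v :: "'a::real_inner"
  assumes "\<And>h. inner h u = inner h v" shows "u = v"
proof -
  have "inner (u - v) (u - v) = 0" using assms[of "u - v"] by (simp add: inner_diff_right)
  then show ?thesis by simp
qed

lemma riesz_map:
  obtains R :: "('a::{real_inner, banach} \<Rightarrow>\<^sub>L real) \<Rightarrow> 'a"
  where "bounded_linear R" "\<And>f h. blinfun_apply f h = inner h (R f)"
proof -
  obtain R :: "('a \<Rightarrow>\<^sub>L real) \<Rightarrow> 'a" where R: "\<And>f h. blinfun_apply f h = inner h (R f)"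
    using riesz_representation by metis
  have "bounded_linear R"
  proof (rule bounded_linear_intro[where K = 1])
    show "R (f + g) = R f + R g" for f g
      by (rule inner_left_eqI) (simp add: R[symmetric] inner_add_right blinfun.add_left)
    show "R (r *\<^sub>R f) = r *\<^sub>R R f" for r f
      by (rule inner_left_eqI) (simp add: R[symmetric] blinfun.scaleR_left)
    show "norm (R f) \<le> norm f * 1" for f
    proof -
      have "norm (R f) * norm (R f) = blinfun_apply f (R f)"
        by (simp add: R power2_norm_eq_inner[symmetric] power2_eq_square)
      also have "\<dots> \<le> norm f * norm (R f)" using norm_blinfun[of f "R f"] by simp
      finally show ?thesis
        by (cases "norm (R f) = 0") (auto simp: mult_le_cancel_right)
    qed
  qed
  then show thesis using R that by blast
qed

lemma grad_eqI:
  assumes "GDERIV f z :> v" shows "grad f z = v"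
  unfolding grad_def
proof (rule the_equality[of "\<lambda>u. GDERIV f z :> u", OF assms])
  fix u assume "GDERIV f z :> u"
  then have eq: "(\<lambda>h. inner h u) = (\<lambda>h. inner h v)"
    using assms unfolding gderiv_def by (rule has_derivative_unique)
  have "inner h u = inner h v" for h using fun_cong[OF eq, of h] by simp
  then show "u = v" by (rule inner_left_eqI)
qed

text \<open>
  The gradient is the bounded linear Riesz map applied to the Frechet derivative, and so it inherits
  differentiability from the latter.
\<close>

lemma C2_grad_hess:
  fixes f :: "'a::{real_inner, banach} \<Rightarrow> real"
  assumes "C2 f"
  shows "GDERIV f z :> grad f z"
    and "(grad f has_derivative blinfun_apply (hess f z)) (at z)"
proof -
  obtain D :: "'a \<Rightarrow> 'a \<Rightarrow>\<^sub>L real" and E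
    where D: "\<And>z. (f has_derivative blinfun_apply (D z)) (at z)"
      and E: "\<And>z. (D has_derivative blinfun_apply (E z)) (at z)"
    using assms unfolding C2_def C1_def by metis
  obtain R :: "('a \<Rightarrow>\<^sub>L real) \<Rightarrow> 'a"
    where R: "bounded_linear R" "\<And>f h. blinfun_apply f h = inner h (R f)"
    using riesz_map by metis
  have G: "GDERIV f z :> R (D z)" for z
    unfolding gderiv_def using D[of z] by (simp add: R(2)[symmetric])
  have gr: "grad f = (\<lambda>z. R (D z))" using grad_eqI[OF G] by auto
  show "GDERIV f z :> grad f z" unfolding gr by (rule G)
  have der: "(grad f has_derivative (\<lambda>h. R (blinfun_apply (E z) h))) (at z)"
    unfolding gr by (rule bounded_linear.has_derivative[OF R(1) E])
  define A where "A = Blinfun (\<lambda>h. R (blinfun_apply (E z) h))"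
  have A: "blinfun_apply A = (\<lambda>h. R (blinfun_apply (E z) h))"
    unfolding A_def by (rule bounded_linear_Blinfun_apply[OF has_derivative_bounded_linear[OF der]])
  have "hess f z = A"
    unfolding hess_def
  proof (rule the_equality)
    show "(grad f has_derivative blinfun_apply A) (at z)" using der A by simp
    fix B assume "(grad f has_derivative blinfun_apply B) (at z)"
    then have "blinfun_apply B = (\<lambda>h. R (blinfun_apply (E z) h))"
      using der by (rule has_derivative_unique)
    then show "B = A" using A by (metis blinfun_apply_inject)
  qed
  then show "(grad f has_derivative blinfun_apply (hess f z)) (at z)" using der A by simp
qed

section \<open>Concave functions of one variable\<close>

lemma second_order_upper_bound:
  fixes f f' f'' :: "real \<Rightarrow> real"
  assumes I: "is_interval I" "c \<in> I" "r \<in> I"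
    and f: "\<And>s. s \<in> I \<Longrightarrow> (f has_real_derivative f' s) (at s)"
    and f': "\<And>s. s \<in> I \<Longrightarrow> (f' has_real_derivative f'' s) (at s)"
    and le: "\<And>s. s \<in> I \<Longrightarrow> \<bar>s - c\<bar> \<le> \<bar>r - c\<bar> \<Longrightarrow> f'' s \<le> - \<delta>"
  shows "f r \<le> f c + f' c * (r - c) - \<delta> / 2 * (r - c)\<^sup>2"
proof (cases "r = c")
  case False
  define diff where "diff m = (if m = 0 then f else if m = 1 then f' else f'')" for m :: nat
  have sub: "t \<in> I" if "min c r \<le> t" "t \<le> max c r" for t
  proof (cases "c \<le> r")
    case True
    with that show ?thesis by (intro mem_is_interval_1_I[OF I(1) I(2,3)]) simp_all
  next
    case False
    with that show ?thesis by (intro mem_is_interval_1_I[OF I(1) I(3,2)]) simp_all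
  qed
  have "\<exists>t. (if r < c then r < t \<and> t < c else c < t \<and> t < r) \<and>
    f r = (\<Sum>m<2. (diff m c / fact m) * (r - c)^m) + (diff 2 t / fact 2) * (r - c)^2"
  proof (rule Taylor[where a = "min c r" and b = "max c r"])
    show "\<forall>m t. m < 2 \<and> min c r \<le> t \<and> t \<le> max c r \<longrightarrow> DERIV (diff m) t :> diff (Suc m) t"
    proof (intro allI impI)
      fix m t assume mt: "m < (2::nat) \<and> min c r \<le> t \<and> t \<le> max c r"
      then have "t \<in> I" using sub by blast
      moreover have "m = 0 \<or> m = 1" using mt by auto
      ultimately show "DERIV (diff m) t :> diff (Suc m) t"
        using f f' by (auto simp: diff_def)
    qed
  qed (use False in \<open>auto simp: diff_def\<close>)
  then obtain t where t: "if r < c then r < t \<and> t < c else c < t \<and> t < r"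
    and eq: "f r = (\<Sum>m<2. (diff m c / fact m) * (r - c)^m) + (diff 2 t / fact 2) * (r - c)^2"
    by blast
  have "f'' t \<le> - \<delta>"
    using t by (intro le sub) (auto split: if_splits)
  then have "f'' t / 2 * (r - c)\<^sup>2 \<le> - \<delta> / 2 * (r - c)\<^sup>2"
    by (intro mult_right_mono) auto
  then show ?thesis using eq by (simp add: diff_def numeral_2_eq_2)
qed simp

text \<open>
  Within distance \<open>\<eta>\<close> of \<open>c\<close> the function lies below a parabola whose maximum exceeds \<open>f c\<close> by
  \<open>A^2 / (2 \<delta>)\<close>. The smallness of \<open>A\<close> makes this parabola return to the level \<open>f c\<close> at distance
  \<open>\<eta>\<close>, and from there on concavity keeps \<open>f\<close> below that level.
\<close>

lemma concave_almost_maximum: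
  fixes f f' f'' :: "real \<Rightarrow> real"
  assumes I: "is_interval I" "\<And>s. \<bar>s - c\<bar> \<le> \<eta> \<Longrightarrow> s \<in> I" "r \<in> I"
    and f: "\<And>s. s \<in> I \<Longrightarrow> (f has_real_derivative f' s) (at s)"
    and f': "\<And>s. s \<in> I \<Longrightarrow> (f' has_real_derivative f'' s) (at s)"
    and concave: "\<And>s. s \<in> I \<Longrightarrow> f'' s \<le> 0"
    and strong: "\<And>s. \<bar>s - c\<bar> \<le> \<eta> \<Longrightarrow> f'' s \<le> - \<delta>"
    and pos: "\<delta> > 0" "\<eta> > 0"
    and A: "\<bar>f' c\<bar> \<le> A" "A \<le> \<delta> * \<eta> / 2"
  shows "f r \<le> f c + A\<^sup>2 / (2 * \<delta>)"
proof -
  have cI: "c \<in> I" using I(2)[of c] pos by simp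
  have quad: "f s \<le> f c + A * \<bar>s - c\<bar> - \<delta> / 2 * \<bar>s - c\<bar>\<^sup>2" if s: "\<bar>s - c\<bar> \<le> \<eta>" for s
  proof -
    have "f s \<le> f c + f' c * (s - c) - \<delta> / 2 * (s - c)\<^sup>2"
    proof (rule second_order_upper_bound[OF I(1) cI I(2)[OF s] f f'])
      fix u assume "\<bar>u - c\<bar> \<le> \<bar>s - c\<bar>"
      then show "f'' u \<le> - \<delta>" using s strong by simp
    qed
    moreover have "f' c * (s - c) \<le> A * \<bar>s - c\<bar>"
      using mult_right_mono[OF A(1), of "\<bar>s - c\<bar>"] abs_ge_self[of "f' c * (s - c)"]
      by (simp add: abs_mult)
    ultimately show ?thesis by simp
  qed
  show ?thesis
  proof (cases "\<bar>r - c\<bar> \<le> \<eta>")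
    case True
    have "A * u - \<delta> / 2 * u\<^sup>2 \<le> A\<^sup>2 / (2 * \<delta>)" for u
    proof -
      have "A\<^sup>2 / (2 * \<delta>) - (A * u - \<delta> / 2 * u\<^sup>2) = (A - \<delta> * u)\<^sup>2 / (2 * \<delta>)"
        using pos by (simp add: field_simps power2_eq_square)
      also have "\<dots> \<ge> 0" using pos by simp
      finally show ?thesis by simp
    qed
    from this[of "\<bar>r - c\<bar>"] show ?thesis using quad[OF True] by linarith
  next
    case False
    define s where "s = c + sgn (r - c) * \<eta>"
    have sc: "\<bar>s - c\<bar> = \<eta>" using False pos by (auto simp: s_def abs_mult sgn_if)
    have "A * \<eta> - \<delta> / 2 * \<eta>\<^sup>2 \<le> 0"
      using A(2) pos by (simp add: power2_eq_square mult_le_cancel_right)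
    with quad[of s] sc have fs: "f s \<le> f c" by simp
    have sI: "s \<in> I" using I(2) sc by simp
    have 1: "f c \<le> f s + f' s * (c - s)"
      using second_order_upper_bound[OF I(1) sI cI f f', of 0] concave by force
    have 2: "f r \<le> f s + f' s * (r - s)"
      using second_order_upper_bound[OF I(1) sI I(3) f f', of 0] concave by force
    have "f' s * (r - s) \<le> 0"
    proof (cases "r > c")
      case True
      then have s: "s = c + \<eta>" "r > s" using False by (auto simp: s_def)
      have "f' s * \<eta> \<le> 0" using 1 fs unfolding s(1) by simp
      then have "f' s \<le> 0" using pos(2) by (simp add: mult_le_0_iff)
      then show ?thesis using s(2) by (intro mult_nonpos_nonneg) auto
    next
      case False': False
      then have s: "s = c - \<eta>" "r < s" using False pos by (auto simp: s_def sgn_if)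
      have "f' s * \<eta> \<ge> 0" using 1 fs unfolding s(1) by simp
      then have "f' s \<ge> 0" using pos(2) by (simp add: zero_le_mult_iff)
      then show ?thesis using s(2) by (intro mult_nonneg_nonpos) auto
    qed
    with 2 fs have "f r \<le> f c" by simp
    moreover have "A\<^sup>2 / (2 * \<delta>) \<ge> 0" using pos by simp
    ultimately show ?thesis by linarith
  qed
qed

section \<open>The strongly indefinite functional\<close>

text \<open>
  The map \<open>g\<close> stands for the gradient of \<open>\<Psi>\<close> and \<open>H\<close> for its second derivative. Hypothesis H1
  enters through the boundedness of \<open>H\<close> on balls.
\<close>

locale strongly_indefinite =
  fixes X Y :: "'a::{real_inner, banach} set"
    and \<Psi> :: "'a \<Rightarrow> real"
    and g :: "'a \<Rightarrow> 'a"
    and H :: "'a \<Rightarrow> 'a \<Rightarrow>\<^sub>L 'a"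
    and p K \<mu> \<kappa> :: real
  assumes X: "subspace X"
    and Y: "subspace Y" "closed Y"
    and orth: "\<And>x y. x \<in> X \<Longrightarrow> y \<in> Y \<Longrightarrow> orthogonal x y"
    and sum: "{x + y |x y. x \<in> X \<and> y \<in> Y} = UNIV"
    and Psi_gderiv: "\<And>z. GDERIV \<Psi> z :> g z"
    and g_deriv: "\<And>z. (g has_derivative blinfun_apply (H z)) (at z)"
    and H_bounded: "\<And>R. \<exists>M. \<forall>v. norm v \<le> R \<longrightarrow> norm (H v) \<le> M"
    and Psi_0: "\<Psi> 0 = 0"
    and p: "p > 2"
    and superquadratic: "\<And>v. inner (g v) v \<ge> p * \<Psi> v"
    and convex: "convex_on UNIV \<Psi>"
    and K: "K > 0"
    and \<mu>: "1/2 < \<mu>" "\<mu> < 1"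
    and growth: "\<And>v. norm (g v) \<le> K * (inner (g v) v) powr \<mu> + \<mu> * norm v"
    and \<kappa>: "\<kappa> > 1"
    and H_quadratic: "\<And>v w. inner (H v (v + w)) (v + w) - 2 * inner (g v) w
                \<ge> \<kappa> * inner (g v) v"
begin

abbreviation P :: "'a \<Rightarrow> 'a" where "P \<equiv> orth_proj X"
abbreviation Q :: "'a \<Rightarrow> 'a" where "Q \<equiv> orth_proj Y"
abbreviation L :: "'a \<Rightarrow> real" where "L \<equiv> energy X Y \<Psi>"

text \<open>
  The isometric involution that represents the quadratic part:
  \<open>L z = \<langle>S z, z\<rangle> / 2 - \<Psi> z\<close>.
\<close>

definition S :: "'a \<Rightarrow> 'a" where "S z = P z - Q z"

definition dL :: "'a \<Rightarrow> 'a" where "dL z = S z - g z"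

subsection \<open>The splitting\<close>

lemma inner_XY: "x \<in> X \<Longrightarrow> y \<in> Y \<Longrightarrow> inner x y = 0" "x \<in> X \<Longrightarrow> y \<in> Y \<Longrightarrow> inner y x = 0"
  using orth by (auto simp: orthogonal_def inner_commute)

lemma splitting: obtains x y where "x \<in> X" "y \<in> Y" "z = x + y"
  using sum by blast

lemma proj_add:
  assumes "x \<in> X" "y \<in> Y"
  shows "P (x + y) = x" "Q (x + y) = y"
proof -
  show "P (x + y) = x"
    unfolding orth_proj_def
  proof (rule the_equality)
    show "x \<in> X \<and> (\<forall>w\<in>X. orthogonal (x + y - x) w)"
      using assms inner_XY by (auto simp: orthogonal_def)
    fix u assume u: "u \<in> X \<and> (\<forall>w\<in>X. orthogonal (x + y - u) w)"
    then have xu: "x - u \<in> X" using assms X by (simp add: subspace_diff)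
    have "inner (x + y - u) (x - u) = 0" using u xu by (auto simp: orthogonal_def)
    moreover have "inner y (x - u) = 0" using inner_XY(2)[OF xu assms(2)] .
    moreover have "x + y - u = (x - u) + y" by simp
    ultimately have "inner (x - u) (x - u) = 0" by (metis add.right_neutral inner_add_left)
    then show "u = x" by simp
  qed
  show "Q (x + y) = y"
    unfolding orth_proj_def
  proof (rule the_equality)
    show "y \<in> Y \<and> (\<forall>w\<in>Y. orthogonal (x + y - y) w)"
      using assms inner_XY by (auto simp: orthogonal_def)
    fix u assume u: "u \<in> Y \<and> (\<forall>w\<in>Y. orthogonal (x + y - u) w)"
    then have yu: "y - u \<in> Y" using assms Y by (simp add: subspace_diff)
    have "inner (x + y - u) (y - u) = 0" using u yu by (auto simp: orthogonal_def)
    moreover have "inner x (y - u) = 0" using inner_XY(1)[OF assms(1) yu] .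
    moreover have "x + y - u = x + (y - u)" by simp
    ultimately have "inner (y - u) (y - u) = 0" by (metis add.left_neutral inner_add_left)
    then show "u = y" by simp
  qed
qed

lemma P_in [simp]: "P z \<in> X" and Q_in [simp]: "Q z \<in> Y" and P_plus_Q: "P z + Q z = z"
  by (rule splitting[of z]; simp add: proj_add)+

lemma S_add: "x \<in> X \<Longrightarrow> y \<in> Y \<Longrightarrow> S (x + y) = x - y"
  by (simp add: S_def proj_add)

lemma norm_add_sq:
  assumes "x \<in> X" "y \<in> Y"
  shows "(norm (x + y))\<^sup>2 = (norm x)\<^sup>2 + (norm y)\<^sup>2" "(norm (x - y))\<^sup>2 = (norm x)\<^sup>2 + (norm y)\<^sup>2"
  using inner_XY[OF assms] unfolding power2_norm_eq_inner by (simp_all add: inner_simps)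

lemma norm_S [simp]: "norm (S z) = norm z"
proof -
  have "(norm (S z))\<^sup>2 = (norm (P z + Q z))\<^sup>2"
    using norm_add_sq[of "P z" "Q z"] by (simp add: S_def)
  then show ?thesis by (simp add: P_plus_Q)
qed

lemma bounded_linear_S: "bounded_linear S"
proof (rule bounded_linear_intro[where K = 1])
  fix z w
  have "S (z + w) = S ((P z + P w) + (Q z + Q w))"
    by (rule arg_cong[of _ _ S]) (metis P_plus_Q add.assoc add.left_commute)
  also have "\<dots> = S z + S w"
    by (subst S_add) (use X Y in \<open>auto simp: S_def subspace_add\<close>)
  finally show "S (z + w) = S z + S w" .
next
  fix r z
  have "S (r *\<^sub>R z) = S (r *\<^sub>R P z + r *\<^sub>R Q z)"
    by (simp add: P_plus_Q flip: scaleR_add_right)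
  also have "\<dots> = r *\<^sub>R S z"
    by (subst S_add) (use X Y in \<open>auto simp: S_def subspace_scale scaleR_diff_right\<close>)
  finally show "S (r *\<^sub>R z) = r *\<^sub>R S z" .
qed simp

lemmas S_linear = bounded_linear.linear[OF bounded_linear_S]
lemmas S_simps = linear_add[OF S_linear] linear_diff[OF S_linear] linear_scale[OF S_linear]
  linear_0[OF S_linear]

lemma S_Y: "y \<in> Y \<Longrightarrow> S y = - y"
  using S_add[of 0 y] X by (simp add: subspace_0)

lemma S_symmetric: "inner (S z) w = inner z (S w)"
proof -
  have "inner (P z - Q z) (P w + Q w) = inner (P z + Q z) (P w - Q w)"
    by (simp add: inner_simps inner_XY)
  then show ?thesis by (simp add: S_def P_plus_Q)
qed

lemma inner_S_self: "inner (S z) z = (norm (P z))\<^sup>2 - (norm (Q z))\<^sup>2"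
proof -
  have "inner (P z - Q z) (P z + Q z) = (norm (P z))\<^sup>2 - (norm (Q z))\<^sup>2"
    unfolding power2_norm_eq_inner by (simp add: inner_simps inner_XY)
  then show ?thesis by (simp add: S_def P_plus_Q)
qed

lemma L_eq: "L z = inner (S z) z / 2 - \<Psi> z"
  by (simp add: energy_def inner_S_self)

lemma L_add: "x \<in> X \<Longrightarrow> y \<in> Y \<Longrightarrow> L (x + y) = ((norm x)\<^sup>2 - (norm y)\<^sup>2) / 2 - \<Psi> (x + y)"
  by (simp add: energy_def proj_add)

subsection \<open>The nonlinearity\<close>

lemma Psi_deriv: "(\<Psi> has_derivative (\<lambda>h. inner h (g z))) (at z)"
  using Psi_gderiv unfolding gderiv_def .

lemma continuous_Psi: "continuous_on UNIV \<Psi>"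
  using Psi_deriv has_derivative_continuous continuous_at_imp_continuous_on by blast

lemma continuous_L: "continuous_on UNIV L"
  unfolding L_eq[abs_def]
  by (intro continuous_intros continuous_Psi linear_continuous_on bounded_linear_S) auto

lemma g_0: "g 0 = 0"
  using growth[of 0] by simp

text \<open>
  By H4 the gradient vanishes at the origin, so the tangent of the convex function \<open>\<Psi>\<close> there is
  zero.
\<close>

lemma Psi_nonneg: "\<Psi> v \<ge> 0"
proof -
  have "convex_on UNIV (\<lambda>t::real. \<Psi> (t *\<^sub>R v))"
  proof (rule convex_onI)
    fix t x y :: real assume "0 < t" "t < 1"
    then show "\<Psi> (((1 - t) *\<^sub>R x + t *\<^sub>R y) *\<^sub>R v) \<le> (1 - t) * \<Psi> (x *\<^sub>R v) + t * \<Psi> (y *\<^sub>R v)"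
      using convex_onD[OF convex, of t "x *\<^sub>R v" "y *\<^sub>R v"] by (simp add: algebra_simps)
  qed simp
  moreover have "((\<lambda>t::real. \<Psi> (t *\<^sub>R v)) has_real_derivative 0) (at 0)"
  proof -
    have "((\<lambda>t::real. \<Psi> (t *\<^sub>R v)) has_derivative (\<lambda>t. inner (t *\<^sub>R v) (g (0 *\<^sub>R v)))) (at 0)"
      by (rule has_derivative_compose[OF _ Psi_deriv]) (auto intro!: derivative_eq_intros)
    moreover have "(*) 0 = (\<lambda>t::real. 0::real)" by auto
    ultimately show ?thesis by (simp add: has_field_derivative_def g_0)
  qed
  ultimately have "\<Psi> (1 *\<^sub>R v) - \<Psi> (0 *\<^sub>R v) \<ge> 0 * (1 - 0)"
    by (intro convex_on_imp_above_tangent[where A = UNIV]) auto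
  then show ?thesis by (simp add: Psi_0)
qed

lemma q_nonneg: "inner (g v) v \<ge> 0"
  using superquadratic[of v] Psi_nonneg[of v] p
  by (smt (verit) mult_nonneg_nonneg)

lemma q_ge_Psi: "inner (g v) v / 2 - \<Psi> v \<ge> (1/2 - 1/p) * inner (g v) v"
  using superquadratic[of v] p by (simp add: field_simps)

text \<open>
  The two estimates below compare \<open>L z\<close> with half of its radial derivative. The quadratic part
  cancels; what remains controls \<open>\<langle>g z, z\<rangle>\<close> from above and from below.
\<close>

lemma q_bound: "(1/2 - 1/p) * inner (g z) z \<le> L z - inner (dL z) z / 2"
  using q_ge_Psi[of z] by (simp add: L_eq dL_def inner_diff_left diff_divide_distrib)

lemma q_lower: "inner (g z) z \<ge> 2 * L z - inner (dL z) z"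
  using Psi_nonneg[of z] by (simp add: L_eq dL_def inner_diff_left)

lemma g_lipschitz:
  obtains M where "M \<ge> 0" "\<And>z w. norm z \<le> R \<Longrightarrow> norm w \<le> R \<Longrightarrow> norm (g z - g w) \<le> M * norm (z - w)"
proof -
  obtain M where M: "\<And>v. norm v \<le> R \<Longrightarrow> norm (H v) \<le> M" using H_bounded by metis
  have "norm (g z - g w) \<le> \<bar>M\<bar> * norm (z - w)" if "norm z \<le> R" "norm w \<le> R" for z w
  proof (rule differentiable_bound[of "cball 0 R" g "\<lambda>z. blinfun_apply (H z)"])
    show "(g has_derivative blinfun_apply (H x)) (at x within cball 0 R)" for x
      using g_deriv has_derivative_at_withinI by blast
    show "onorm (blinfun_apply (H x)) \<le> \<bar>M\<bar>" if "x \<in> cball 0 R" for x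
      using M[of x] that by (simp add: norm_blinfun.rep_eq[symmetric])
  qed (use that in auto)
  then show thesis using that[of "\<bar>M\<bar>"] by auto
qed

lemma dL_lipschitz:
  obtains M where "M \<ge> 0" "\<And>z w. norm z \<le> R \<Longrightarrow> norm w \<le> R \<Longrightarrow> norm (dL z - dL w) \<le> M * norm (z - w)"
proof -
  obtain M where M: "M \<ge> 0" "\<And>z w. norm z \<le> R \<Longrightarrow> norm w \<le> R \<Longrightarrow> norm (g z - g w) \<le> M * norm (z - w)"
    using g_lipschitz by blast
  have "norm (dL z - dL w) \<le> (1 + M) * norm (z - w)" if "norm z \<le> R" "norm w \<le> R" for z w
  proof -
    have "dL z - dL w = S (z - w) - (g z - g w)" by (simp add: dL_def S_simps)
    then have "norm (dL z - dL w) \<le> norm (z - w) + norm (g z - g w)"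
      by (metis norm_S norm_triangle_ineq4)
    then show ?thesis using M(2)[OF that] by (simp add: algebra_simps)
  qed
  then show thesis using that[of "1 + M"] M(1) by auto
qed

lemma L_gderiv: "GDERIV L z :> dL z"
proof -
  have "(L has_derivative (\<lambda>h. (inner (S z) h + inner (S h) z) / 2 - inner h (g z))) (at z)"
    unfolding L_eq[abs_def]
    by (auto intro!: derivative_eq_intros Psi_deriv bounded_linear.has_derivative[OF bounded_linear_S])
  moreover have "(inner (S z) h + inner (S h) z) / 2 - inner h (g z) = inner h (dL z)" for h
    using S_symmetric[of h z] by (simp add: dL_def inner_diff_right inner_commute)
  ultimately show ?thesis by (simp add: gderiv_def)
qed

lemma L_deriv: "(L has_derivative (\<lambda>h. inner h (dL z))) (at z)"
  using L_gderiv unfolding gderiv_def .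

lemma grad_L: "grad L = dL"
  using grad_eqI[OF L_gderiv] by blast

lemma dL_deriv: "(dL has_derivative (\<lambda>h. S h - blinfun_apply (H z) h)) (at z)"
  unfolding dL_def[abs_def]
  by (intro has_derivative_diff g_deriv bounded_linear.has_derivative[OF bounded_linear_S]
      has_derivative_ident)

lemma continuous_dL: "continuous_on UNIV dL"
  using dL_deriv has_derivative_continuous continuous_at_imp_continuous_on by blast

lemma dL_0: "dL 0 = 0"
  by (simp add: dL_def S_simps g_0)

lemma L_0: "L 0 = 0"
  by (simp add: L_eq Psi_0)

lemma L_line_deriv:
  "((\<lambda>t. L (z + t *\<^sub>R v)) has_real_derivative inner v (dL (z + t *\<^sub>R v))) (at t)"
proof -
  have "((\<lambda>t. L (z + t *\<^sub>R v)) has_derivative (\<lambda>s. inner (s *\<^sub>R v) (dL (z + t *\<^sub>R v)))) (at t)"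
    by (rule has_derivative_compose[OF _ L_deriv]) (auto intro!: derivative_eq_intros)
  then show ?thesis by (simp add: has_field_derivative_def mult_commute_abs)
qed

lemma L_taylor:
  assumes M: "M \<ge> 0" "\<And>z w. norm z \<le> R \<Longrightarrow> norm w \<le> R \<Longrightarrow> norm (dL z - dL w) \<le> M * norm (z - w)"
    and R: "norm z \<le> R" "norm (z + v) \<le> R"
  shows "\<bar>L (z + v) - L z - inner (dL z) v\<bar> \<le> M * (norm v)\<^sup>2"
proof -
  obtain s :: real where s: "0 < s" "s < 1"
    and eq: "L (z + 1 *\<^sub>R v) - L (z + 0 *\<^sub>R v) = (1 - 0) * inner v (dL (z + s *\<^sub>R v))"
    using MVT2[of 0 1 "\<lambda>t. L (z + t *\<^sub>R v)" "\<lambda>t. inner v (dL (z + t *\<^sub>R v))"] L_line_deriv by auto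
  have "z + s *\<^sub>R v = (1 - s) *\<^sub>R z + s *\<^sub>R (z + v)" by (simp add: algebra_simps)
  then have R': "norm (z + s *\<^sub>R v) \<le> R"
    using convexD[OF convex_cball[of 0 R], of z "z + v" "1 - s" s] R s by simp
  have "\<bar>L (z + v) - L z - inner (dL z) v\<bar> = \<bar>inner v (dL (z + s *\<^sub>R v) - dL z)\<bar>"
    using eq by (simp add: inner_diff_right inner_commute)
  also have "\<dots> \<le> norm v * norm (dL (z + s *\<^sub>R v) - dL z)"
    by (rule Cauchy_Schwarz_ineq2)
  also have "\<dots> \<le> norm v * (M * norm (s *\<^sub>R v))"
    using M(2)[OF R' R(1)] by (intro mult_left_mono) auto
  also have "\<dots> = s * (M * (norm v)\<^sup>2)"
    using s by (simp add: power2_eq_square)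
  also have "\<dots> \<le> 1 * (M * (norm v)\<^sup>2)"
    using s M(1) by (intro mult_right_mono) auto
  finally show ?thesis by simp
qed

subsection \<open>Maximization over the negative directions\<close>

text \<open>
  On \<open>x + Y\<close> the functional is \<open>- |w|^2 / 2\<close> plus a concave function, hence strongly concave.
\<close>

lemma ex1_maximizer:
  assumes "x \<in> X"
  shows "\<exists>!w. w \<in> Y \<and> (\<forall>v\<in>Y. L (x + v) \<le> L (x + w))"
proof (rule strongly_midpoint_concave_has_maximizer[OF Y])
  show "continuous_on UNIV (\<lambda>w. L (x + w))"
    by (rule continuous_on_compose2[OF continuous_L]) (auto intro!: continuous_intros)
  show "L (x + w) \<le> (norm x)\<^sup>2 / 2" if "w \<in> Y" for w
    using Psi_nonneg[of "x + w"] zero_le_power2[of "norm w"]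
    unfolding L_add[OF assms that] by argo
  show "L (x + (1/2) *\<^sub>R (a + b)) \<ge> (L (x + a) + L (x + b)) / 2 + (norm (a - b))\<^sup>2 / 8"
    if ab: "a \<in> Y" "b \<in> Y" for a b
  proof -
    have "(1/2) *\<^sub>R (a + b) \<in> Y" using ab Y by (simp add: subspace_add subspace_scale)
    note L_add[OF assms this] L_add[OF assms ab(1)] L_add[OF assms ab(2)]
    moreover have "x + (1/2) *\<^sub>R (a + b) = (1 - 1/2) *\<^sub>R (x + a) + (1/2) *\<^sub>R (x + b)"
      by (simp add: algebra_simps flip: scaleR_add_left)
    then have "\<Psi> (x + (1/2) *\<^sub>R (a + b)) \<le> (1 - 1/2) * \<Psi> (x + a) + (1/2) * \<Psi> (x + b)"
      using convex_onD[OF convex, of "1/2" "x + a" "x + b"] by simp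
    ultimately show ?thesis
      unfolding parallelogram_midpoint by (simp add: field_simps)
  qed
qed

lemma maximizer:
  assumes "x \<in> X"
  shows "maximizer Y L x \<in> Y" "\<And>v. v \<in> Y \<Longrightarrow> L (x + v) \<le> L (x + maximizer Y L x)"
  using theI'[OF ex1_maximizer[OF assms]] unfolding maximizer_def by blast+

lemma reduced_ge: "x \<in> X \<Longrightarrow> v \<in> Y \<Longrightarrow> L (x + v) \<le> reduced Y L x"
  unfolding reduced_def by (rule maximizer)

lemma reduced_attained:
  assumes "x \<in> X"
  obtains w where "w \<in> Y" "reduced Y L x = L (x + w)" "\<And>v. v \<in> Y \<Longrightarrow> inner (dL (x + w)) v = 0"
proof -
  define w where "w = maximizer Y L x"
  have w: "w \<in> Y" "\<And>v. v \<in> Y \<Longrightarrow> L (x + v) \<le> L (x + w)"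
    using maximizer[OF assms] by (auto simp: w_def)
  have "inner (dL (x + w)) v = 0" if "v \<in> Y" for v
  proof -
    have "((\<lambda>t. L (x + w + t *\<^sub>R v)) has_real_derivative inner v (dL (x + w + 0 *\<^sub>R v))) (at 0)"
      by (rule L_line_deriv)
    then have "inner v (dL (x + w + 0 *\<^sub>R v)) = 0"
    proof (rule DERIV_local_max[where d = 1])
      have "L (x + (w + t *\<^sub>R v)) \<le> L (x + w)" for t
        using that w(1) Y by (intro w(2)) (simp add: subspace_add subspace_scale)
      then show "\<forall>t. \<bar>0 - t\<bar> < 1 \<longrightarrow> L (x + w + t *\<^sub>R v) \<le> L (x + w + 0 *\<^sub>R v)"
        by (simp add: add.assoc)
    qed simp
    then show ?thesis by (simp add: inner_commute)
  qed
  then show thesis using that[of w] w(1) by (simp add: reduced_def w_def)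
qed

subsection \<open>Curves along which the functional is concave\<close>

text \<open>
  In the parameter \<open>s\<close> with \<open>r = exp (2 s)\<close> these are the solutions of \<open>z'' = z\<close>, with decaying
  part \<open>b\<close>; the functional is concave in \<open>r\<close> along those with \<open>b\<close> in \<open>Y\<close>.
\<close>

definition curve :: "'a \<Rightarrow> 'a \<Rightarrow> real \<Rightarrow> 'a" where
  "curve a b r = sqrt r *\<^sub>R a + (1 / sqrt r) *\<^sub>R b"

definition curve' :: "'a \<Rightarrow> 'a \<Rightarrow> real \<Rightarrow> 'a" where
  "curve' a b r = (1 / (2 * r)) *\<^sub>R (curve a b r - (2 / sqrt r) *\<^sub>R b)"

definition slope :: "'a \<Rightarrow> 'a \<Rightarrow> real \<Rightarrow> real" where
  "slope a b r = inner (dL (curve a b r)) (curve' a b r)"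

lemma curve_deriv:
  assumes r: "r > 0"
  shows "(curve a b has_vector_derivative curve' a b r) (at r)"
    and "(curve' a b has_vector_derivative
           - (1 / (4 * r\<^sup>2)) *\<^sub>R (curve a b r - (4 / sqrt r) *\<^sub>R b)) (at r)"
proof -
  have rr: "sqrt r * sqrt r = r" "sqrt r > 0" using r by auto
  have d1: "((\<lambda>r. sqrt r) has_real_derivative 1 / (2 * sqrt r)) (at r)"
    using r by (auto intro!: derivative_eq_intros simp: field_simps)
  have d2: "((\<lambda>r. 1 / sqrt r) has_real_derivative - (1 / (2 * r * sqrt r))) (at r)"
    using rr r by (auto intro!: derivative_eq_intros d1 simp: field_simps)
  have d3: "((\<lambda>r. 1 / (2 * sqrt r)) has_real_derivative - (1 / (4 * r * sqrt r))) (at r)"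
    using rr r by (auto intro!: derivative_eq_intros d1 simp: field_simps)
  have d4: "((\<lambda>r. 1 / (2 * r * sqrt r)) has_real_derivative - (3 / (4 * r * r * sqrt r))) (at r)"
  proof -
    have "((\<lambda>r. 1 / (2 * r * sqrt r)) has_real_derivative
      - ((2 * sqrt r + 2 * r * (1 / (2 * sqrt r))) / ((2 * r * sqrt r) * (2 * r * sqrt r)))) (at r)"
      using rr r by (auto intro!: derivative_eq_intros d1 simp: field_simps)
    moreover have "(2 * sqrt r + 2 * r * (1 / (2 * sqrt r))) / ((2 * r * sqrt r) * (2 * r * sqrt r))
      = 3 / (4 * r * r * sqrt r)"
    proof -
      have "2 * r * (1 / (2 * sqrt r)) = sqrt r" using rr by (simp add: field_simps)
      moreover have "(2 * r * sqrt r) * (2 * r * sqrt r) = 4 * r * r * (sqrt r * sqrt r)"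
        by (simp add: algebra_simps)
      then have "(2 * r * sqrt r) * (2 * r * sqrt r) = 4 * r * r * r" using rr by simp
      moreover have "3 * sqrt r / (4 * r * r * r) = 3 / (4 * r * r * sqrt r)"
        using rr r by (simp add: field_simps)
      ultimately show ?thesis by simp
    qed
    ultimately show ?thesis by simp
  qed
  have eq: "curve' a b r = (1 / (2 * sqrt r)) *\<^sub>R a - (1 / (2 * r * sqrt r)) *\<^sub>R b" if "r > 0" for r
  proof -
    have "sqrt r / (2 * r) = 1 / (2 * sqrt r)" using that by (simp add: field_simps)
    then show ?thesis
      by (simp add: curve'_def curve_def scaleR_add_right scaleR_diff_right algebra_simps
          flip: scaleR_add_left)
  qed
  have "(curve a b has_vector_derivative
      (1 / (2 * sqrt r)) *\<^sub>R a + (- (1 / (2 * r * sqrt r))) *\<^sub>R b) (at r)"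
    unfolding curve_def[abs_def]
    by (intro has_vector_derivative_add has_vector_derivative_scaleR[OF _ has_vector_derivative_const, simplified] d1 d2)
  then show "(curve a b has_vector_derivative curve' a b r) (at r)"
    using eq[OF r] by simp
  have "((\<lambda>r. (1 / (2 * sqrt r)) *\<^sub>R a - (1 / (2 * r * sqrt r)) *\<^sub>R b) has_vector_derivative
      (- (1 / (4 * r * sqrt r))) *\<^sub>R a - (- (3 / (4 * r * r * sqrt r))) *\<^sub>R b) (at r)"
    by (intro has_vector_derivative_diff has_vector_derivative_scaleR[OF _ has_vector_derivative_const, simplified] d3 d4)
  moreover have "(- (1 / (4 * r * sqrt r))) *\<^sub>R a - (- (3 / (4 * r * r * sqrt r))) *\<^sub>R b
    = - (1 / (4 * r\<^sup>2)) *\<^sub>R (curve a b r - (4 / sqrt r) *\<^sub>R b)"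
  proof -
    have e1: "- (1 / (4 * r\<^sup>2)) * sqrt r = - (1 / (4 * r * sqrt r))"
      using r by (simp add: field_simps power2_eq_square)
    have e2: "- (1 / (4 * r\<^sup>2)) * (1 / sqrt r - 4 / sqrt r) = 3 / (4 * r * r * sqrt r)"
      using r by (simp add: field_simps power2_eq_square)
    have e3: "curve a b r - (4 / sqrt r) *\<^sub>R b = sqrt r *\<^sub>R a + (1 / sqrt r - 4 / sqrt r) *\<^sub>R b"
      unfolding curve_def scaleR_diff_left by simp
    show ?thesis unfolding e3 scaleR_add_right scaleR_scaleR e1 e2 by simp
  qed
  ultimately have "((\<lambda>r. (1 / (2 * sqrt r)) *\<^sub>R a - (1 / (2 * r * sqrt r)) *\<^sub>R b) has_vector_derivative
      - (1 / (4 * r\<^sup>2)) *\<^sub>R (curve a b r - (4 / sqrt r) *\<^sub>R b)) (at r)" by simp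
  then show "(curve' a b has_vector_derivative
      - (1 / (4 * r\<^sup>2)) *\<^sub>R (curve a b r - (4 / sqrt r) *\<^sub>R b)) (at r)"
    by (rule has_vector_derivative_transform_within_open[where S = "{0<..}"]) (use r eq in auto)
qed

lemma L_curve_deriv:
  assumes "r > 0"
  shows "((\<lambda>r. L (curve a b r)) has_real_derivative slope a b r) (at r)"
proof -
  have "((\<lambda>r. L (curve a b r)) has_derivative
      (\<lambda>s. inner (s *\<^sub>R curve' a b r) (dL (curve a b r)))) (at r)"
    using has_derivative_compose[OF curve_deriv(1)[OF assms, unfolded has_vector_derivative_def] L_deriv] .
  then show ?thesis
    by (simp add: has_field_derivative_def slope_def mult_commute_abs inner_commute)
qed

text \<open>
  The algebraic core. With \<open>w = - (2 / sqrt r) b\<close> the velocity of the curve is \<open>(z + w) / (2 r)\<close> and its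
  acceleration is \<open>- (z + 2 w) / (4 r^2)\<close>; up to the factor \<open>1 / (4 r^2)\<close> the left-hand side is
  therefore the second derivative of \<open>L\<close> along the curve. In the term with \<open>z + 2 w\<close>
  the contributions \<open>2 \<langle>g z, w\<rangle>\<close> and \<open>2 \<langle>z, w\<rangle>\<close> cancel those of H5 and of the quadratic part,
  for every point \<open>z\<close> and not only for maximizers on \<open>z + Y\<close>.
\<close>

lemma second_derivative_bound:
  assumes w: "w \<in> Y"
  shows "inner (S (z + w) - blinfun_apply (H z) (z + w)) (z + w) - inner (dL z) (z + 2 *\<^sub>R w)
    \<le> - (norm w)\<^sup>2 - (\<kappa> - 1) * inner (g z) z"
proof -
  have "inner (S z) w = - inner z w" "inner (S w) z = - inner z w" "inner (S w) w = - (norm w)\<^sup>2"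
    using S_Y[OF w] S_symmetric[of z w] by (simp_all add: power2_norm_eq_inner inner_commute)
  moreover have "inner (blinfun_apply (H z) (z + w)) (z + w) \<ge> 2 * inner (g z) w + \<kappa> * inner (g z) z"
    using H_quadratic[of z w] by simp
  ultimately show ?thesis
    by (simp add: dL_def S_simps inner_diff_left inner_add_left inner_add_right
        distrib_right left_diff_distrib del: blinfun.add_right)
qed

lemma slope_deriv:
  assumes r: "r > 0" and b: "b \<in> Y"
  shows "\<exists>D. (slope a b has_real_derivative D) (at r) \<and>
    D \<le> - (4 * (norm b)\<^sup>2 / r + (\<kappa> - 1) * inner (g (curve a b r)) (curve a b r)) / (4 * r\<^sup>2)"
proof -
  define z where "z = curve a b r"
  define w where "w = - (2 / sqrt r) *\<^sub>R b"
  define B where "B = inner (S (z + w) - blinfun_apply (H z) (z + w)) (z + w) - inner (dL z) (z + 2 *\<^sub>R w)"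
  have w: "w \<in> Y" using b Y by (simp add: w_def subspace_scale subspace_neg)
  have c': "curve' a b r = (1 / (2 * r)) *\<^sub>R (z + w)" by (simp add: curve'_def z_def w_def)
  have c'': "curve a b r - (4 / sqrt r) *\<^sub>R b = z + 2 *\<^sub>R w" by (simp add: z_def w_def)
  have d1: "((\<lambda>r. dL (curve a b r)) has_derivative (\<lambda>s. S (s *\<^sub>R curve' a b r) -
      blinfun_apply (H z) (s *\<^sub>R curve' a b r))) (at r)"
    using has_derivative_compose[OF curve_deriv(1)[OF r, unfolded has_vector_derivative_def] dL_deriv]
    by (simp add: z_def)
  have "(slope a b has_derivative (\<lambda>s. inner (dL z) (s *\<^sub>R (- (1 / (4 * r\<^sup>2)) *\<^sub>R (z + 2 *\<^sub>R w)))
      + inner (S (s *\<^sub>R curve' a b r) - blinfun_apply (H z) (s *\<^sub>R curve' a b r)) (curve' a b r))) (at r)"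
    unfolding slope_def[abs_def] z_def
    by (rule has_derivative_inner[OF d1[unfolded z_def] curve_deriv(2)[OF r, of a b, unfolded has_vector_derivative_def c''[unfolded z_def]]])
  moreover have "inner (dL z) (s *\<^sub>R (- (1 / (4 * r\<^sup>2)) *\<^sub>R (z + 2 *\<^sub>R w)))
      + inner (S (s *\<^sub>R curve' a b r) - blinfun_apply (H z) (s *\<^sub>R curve' a b r)) (curve' a b r)
    = s * (B / (4 * r\<^sup>2))" for s
  proof -
    have 1: "inner (dL z) (s *\<^sub>R (- (1 / (4 * r\<^sup>2)) *\<^sub>R (z + 2 *\<^sub>R w)))
      = - s / (4 * r\<^sup>2) * inner (dL z) (z + 2 *\<^sub>R w)"
      by (simp only: inner_scaleR_right) simp
    have "S (s *\<^sub>R curve' a b r) - blinfun_apply (H z) (s *\<^sub>R curve' a b r)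
      = (s / (2 * r)) *\<^sub>R (S (z + w) - blinfun_apply (H z) (z + w))"
      unfolding c' by (simp only: S_simps blinfun.scaleR_right scaleR_diff_right) simp
    then have 2: "inner (S (s *\<^sub>R curve' a b r) - blinfun_apply (H z) (s *\<^sub>R curve' a b r)) (curve' a b r)
      = s / (4 * r\<^sup>2) * inner (S (z + w) - blinfun_apply (H z) (z + w)) (z + w)"
      unfolding c' by (simp only: inner_scaleR_left inner_scaleR_right) (simp add: power2_eq_square)
    show ?thesis unfolding 1 2 B_def by (simp add: diff_divide_distrib right_diff_distrib)
  qed
  ultimately have "(slope a b has_real_derivative B / (4 * r\<^sup>2)) (at r)"
    unfolding has_field_derivative_def by (simp only: mult_commute_abs)
  moreover have "B / (4 * r\<^sup>2) \<le> (- (norm w)\<^sup>2 - (\<kappa> - 1) * inner (g z) z) / (4 * r\<^sup>2)"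
    unfolding B_def by (intro divide_right_mono second_derivative_bound w) simp
  moreover have "(norm w)\<^sup>2 = 4 * (norm b)\<^sup>2 / r"
    using r by (simp add: w_def power_mult_distrib power_divide)
  ultimately show ?thesis unfolding z_def by (intro exI[of _ "B / (4 * r\<^sup>2)"]) simp
qed

lemma L_concave_along_curve:
  assumes b: "b \<in> Y" and r: "r > 0"
  shows "L (curve (z - b) b r) \<le> L z + inner (dL z) (z - 2 *\<^sub>R b) / 2 * (r - 1)"
proof -
  obtain D where D: "\<And>r. r > 0 \<Longrightarrow> (slope (z - b) b has_real_derivative D r) (at r)"
    "\<And>r. r > 0 \<Longrightarrow> D r \<le> - (4 * (norm b)\<^sup>2 / r +
      (\<kappa> - 1) * inner (g (curve (z - b) b r)) (curve (z - b) b r)) / (4 * r\<^sup>2)"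
    using slope_deriv[OF _ b, of _ "z - b"] by metis
  have "L (curve (z - b) b r) \<le> L (curve (z - b) b 1) + slope (z - b) b 1 * (r - 1) - 0 / 2 * (r - 1)\<^sup>2"
  proof (rule second_order_upper_bound[where I = "{0<..}" and f'' = D])
    fix s :: real assume s: "s \<in> {0<..}"
    have "0 \<le> (\<kappa> - 1) * inner (g (curve (z - b) b s)) (curve (z - b) b s)"
      using \<kappa> q_nonneg by simp
    moreover have "0 \<le> 4 * (norm b)\<^sup>2 / s" using s by simp
    ultimately have "- (4 * (norm b)\<^sup>2 / s +
      (\<kappa> - 1) * inner (g (curve (z - b) b s)) (curve (z - b) b s)) / (4 * s\<^sup>2) \<le> 0"
      by (intro divide_nonpos_nonneg) auto
    then show "D s \<le> - 0" using D(2)[of s] s by simp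
  qed (use r D(1) L_curve_deriv in \<open>auto simp: is_interval_oi\<close>)
  moreover have "curve (z - b) b 1 = z" by (simp add: curve_def)
  moreover have "slope (z - b) b 1 = inner (dL z) (z - 2 *\<^sub>R b) / 2"
    by (simp add: slope_def curve'_def \<open>curve (z - b) b 1 = z\<close>)
  ultimately show ?thesis by simp
qed

text \<open>
  At \<open>r = t^2\<close> the curve through \<open>z\<close> sits at \<open>t z + (1 / t - t) b\<close>. Since \<open>1 / t \<noteq> t\<close>, the component in
  \<open>Y\<close> can be prescribed by the choice of \<open>b\<close>.
\<close>

lemma curve_reaches:
  assumes t: "t > 0" "t \<noteq> 1" and w: "w \<in> Y"
  obtains b where "b \<in> Y" "curve (z - b) b (t\<^sup>2) = t *\<^sub>R P z + w"
proof
  define s where "s = 1 / t - t"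
  define b where "b = (1 / s) *\<^sub>R (w - t *\<^sub>R Q z)"
  have "s \<noteq> 0"
  proof
    assume "s = 0"
    then have "t\<^sup>2 = 1" using t by (simp add: s_def field_simps power2_eq_square)
    then show False using t by (simp add: power2_eq_1_iff)
  qed
  show "b \<in> Y" unfolding b_def using w Y by (simp add: subspace_scale subspace_diff)
  have "curve (z - b) b (t\<^sup>2) = t *\<^sub>R z + s *\<^sub>R b"
    using t by (simp add: curve_def s_def algebra_simps)
  also have "\<dots> = t *\<^sub>R (P z + Q z) + (w - t *\<^sub>R Q z)"
    using \<open>s \<noteq> 0\<close> by (simp add: b_def P_plus_Q)
  also have "\<dots> = t *\<^sub>R P z + w" by (simp add: scaleR_add_right)
  finally show "curve (z - b) b (t\<^sup>2) = t *\<^sub>R P z + w" .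
qed

subsection \<open>Almost critical points almost maximize their half space\<close>

lemma curve_displacement:
  assumes s: "\<bar>s - 1\<bar> \<le> 1/2"
  shows "norm (curve (z - b) b s - z) \<le> \<bar>s - 1\<bar> * (norm z + 3 * norm b)"
proof -
  have s0: "s \<ge> 1/2" using s by arith
  have "sqrt (1/4) \<le> sqrt s" using s0 by simp
  then have r: "sqrt s \<ge> 1/2" by (simp add: real_sqrt_divide)
  have "(sqrt s - 1) * (sqrt s + 1) = s - 1" using s0 by (simp add: algebra_simps)
  then have "\<bar>s - 1\<bar> = \<bar>sqrt s - 1\<bar> * (sqrt s + 1)" using r s0 by (simp add: abs_mult flip: \<open>_ = s - 1\<close>)
  moreover have "\<bar>sqrt s - 1\<bar> * 1 \<le> \<bar>sqrt s - 1\<bar> * (sqrt s + 1)"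
    using r s0 by (intro mult_left_mono) auto
  ultimately have 1: "\<bar>sqrt s - 1\<bar> \<le> \<bar>s - 1\<bar>" by simp
  have "\<bar>1 / sqrt s - 1\<bar> = \<bar>sqrt s - 1\<bar> / sqrt s"
  proof -
    have "1 / sqrt s - 1 = (1 - sqrt s) / sqrt s" using r s0 by (simp add: diff_divide_distrib)
    then show ?thesis using s0 by (simp add: abs_minus_commute)
  qed
  also have "\<dots> \<le> \<bar>sqrt s - 1\<bar> / (1/2)" using r s0 by (intro divide_left_mono) auto
  finally have 2: "\<bar>1 / sqrt s - 1\<bar> \<le> 2 * \<bar>s - 1\<bar>" using 1 by simp
  have "curve (z - b) b s - z = (sqrt s - 1) *\<^sub>R (z - b) + (1 / sqrt s - 1) *\<^sub>R b"
    by (simp add: curve_def algebra_simps)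
  then have "norm (curve (z - b) b s - z) \<le> \<bar>sqrt s - 1\<bar> * norm (z - b) + \<bar>1 / sqrt s - 1\<bar> * norm b"
    by (metis norm_scaleR norm_triangle_ineq)
  also have "\<dots> \<le> \<bar>s - 1\<bar> * (norm z + norm b) + (2 * \<bar>s - 1\<bar>) * norm b"
    using 1 2 norm_triangle_ineq4[of z b] by (intro add_mono mult_mono) auto
  finally show ?thesis by (simp add: algebra_simps)
qed

text \<open>
  Uniform continuity of \<open>\<langle>g z, z\<rangle>\<close> on balls; it preserves the lower bound that \<open>q_lower\<close>
  provides at a point of positive energy.
\<close>

lemma q_stays_large:
  assumes R: "R \<ge> 0" and c: "c > 0"
  obtains \<zeta> where "\<zeta> > 0"
    "\<And>z z'. norm z \<le> R \<Longrightarrow> norm (z' - z) \<le> \<zeta> \<Longrightarrow> inner (g z') z' \<ge> inner (g z) z - c"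
proof -
  obtain M where M: "M \<ge> 0"
    "\<And>z w. norm z \<le> R + 1 \<Longrightarrow> norm w \<le> R + 1 \<Longrightarrow> norm (g z - g w) \<le> M * norm (z - w)"
    using g_lipschitz by blast
  define \<zeta> where "\<zeta> = min 1 (c / (2 * (M + 1) * (R + 1)))"
  have \<zeta>: "\<zeta> > 0" "\<zeta> \<le> 1" using M(1) R c by (auto simp: \<zeta>_def)
  have "2 * (M + 1) * (R + 1) * \<zeta> \<le> 2 * (M + 1) * (R + 1) * (c / (2 * (M + 1) * (R + 1)))"
    using M(1) R by (intro mult_left_mono) (auto simp: \<zeta>_def)
  also have "\<dots> = c" using M(1) R by simp
  finally have \<zeta>c: "2 * (M + 1) * (R + 1) * \<zeta> \<le> c" .
  have "inner (g z') z' \<ge> inner (g z) z - c" if z: "norm z \<le> R" "norm (z' - z) \<le> \<zeta>" for z z'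
  proof -
    have z': "norm z' \<le> R + 1"
      using z \<zeta>(2) norm_triangle_ineq[of z "z' - z"] by simp
    have "norm (g z' - g 0) \<le> M * norm (z' - 0)" using z' R by (intro M(2)) auto
    then have "norm (g z') \<le> M * (R + 1)"
      using z' M(1) mult_left_mono[OF z' M(1)] by (simp add: g_0)
    then have a: "norm (g z') * norm (z' - z) \<le> M * (R + 1) * \<zeta>"
      using z \<zeta> by (intro mult_mono) (auto simp: M(1) R)
    have "norm (g z' - g z) \<le> M * \<zeta>"
      using M(2)[OF z', of z] z mult_left_mono[OF z(2) M(1)] by simp
    then have b: "norm (g z' - g z) * norm z \<le> M * \<zeta> * (R + 1)"
      using z \<zeta> M(1) by (intro mult_mono) auto
    have "inner (g z') z' - inner (g z) z = inner (g z') (z' - z) + inner (g z' - g z) z"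
      by (simp add: inner_diff_left inner_diff_right)
    moreover have "\<bar>inner (g z') (z' - z)\<bar> \<le> M * (R + 1) * \<zeta>"
      using Cauchy_Schwarz_ineq2 a order_trans by blast
    moreover have "\<bar>inner (g z' - g z) z\<bar> \<le> M * \<zeta> * (R + 1)"
      using Cauchy_Schwarz_ineq2 b order_trans by blast
    moreover have "2 * (M * (R + 1) * \<zeta>) \<le> 2 * (M + 1) * (R + 1) * \<zeta>"
      using R \<zeta> by (simp add: algebra_simps)
    moreover have "M * \<zeta> * (R + 1) = M * (R + 1) * \<zeta>" by simp
    ultimately show ?thesis using \<zeta>c by linarith
  qed
  with \<zeta>(1) that show thesis by blast
qed

text \<open>
  The constants must not depend on the target point, although the vector \<open>b\<close> of the curve that
  leads to it can be arbitrarily long. Everything scales with \<open>d = 1 + |b|\<close>: the starting slope is at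
  most \<open>e d\<close>, the curve stays near \<open>z\<close> for \<open>|r - 1| \<le> \<eta> / d\<close>, and there the concavity is at least
  \<open>\<delta> d^2\<close>. The possible gain \<open>(e d)^2 / (2 \<delta> d^2)\<close> is free of \<open>d\<close>.
\<close>

lemma almost_maximal_off_ray:
  assumes R: "R \<ge> 0" and c: "c > 0"
  obtains e0 C where "e0 > 0" "C \<ge> 0"
    "\<And>z e t w. norm z \<le> R \<Longrightarrow> L z \<ge> c \<Longrightarrow> \<bar>inner (dL z) z\<bar> \<le> e \<Longrightarrow>
       (\<And>y. y \<in> Y \<Longrightarrow> \<bar>inner (dL z) y\<bar> \<le> e * norm y) \<Longrightarrow> e \<le> e0 \<Longrightarrow>
       t > 0 \<Longrightarrow> t \<noteq> 1 \<Longrightarrow> w \<in> Y \<Longrightarrow> L (t *\<^sub>R P z + w) \<le> L z + C * e\<^sup>2"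
proof -
  obtain \<zeta> where \<zeta>: "\<zeta> > 0"
    "\<And>z z'. norm z \<le> R \<Longrightarrow> norm (z' - z) \<le> \<zeta> \<Longrightarrow> inner (g z') z' \<ge> inner (g z) z - c / 2"
    using q_stays_large[OF R, of "c / 2"] c by auto
  define \<eta> where "\<eta> = min (1/2) (\<zeta> / (R + 3))"
  have \<eta>: "\<eta> > 0" "\<eta> \<le> 1/2" using \<zeta>(1) R min.cobounded1[of "1/2" "\<zeta> / (R + 3)"]
    by (simp_all add: \<eta>_def)
  have "\<eta> * (R + 3) \<le> \<zeta> / (R + 3) * (R + 3)" using R by (intro mult_right_mono) (auto simp: \<eta>_def)
  then have \<eta>\<zeta>: "\<eta> * (R + 3) \<le> \<zeta>" using R by simp
  define \<delta> where "\<delta> = min 2 ((\<kappa> - 1) * c) / 32"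
  have \<delta>: "\<delta> > 0" "32 * \<delta> \<le> 2" "32 * \<delta> \<le> (\<kappa> - 1) * c" using c \<kappa> by (auto simp: \<delta>_def)
  define e0 where "e0 = min (c / 2) (\<delta> * \<eta> / 2)"
  have e0: "e0 > 0" "e0 \<le> c / 2" "e0 \<le> \<delta> * \<eta> / 2" using c \<delta> \<eta> by (auto simp: e0_def)
  show thesis
  proof (rule that[of e0 "1 / (2 * \<delta>)"])
    fix z e w and t :: real
    assume z: "norm z \<le> R" "L z \<ge> c" and e: "\<bar>inner (dL z) z\<bar> \<le> e"
      "\<And>y. y \<in> Y \<Longrightarrow> \<bar>inner (dL z) y\<bar> \<le> e * norm y" "e \<le> e0"
      and t: "t > 0" "t \<noteq> 1" and w: "w \<in> Y"
    obtain b where b: "b \<in> Y" "curve (z - b) b (t\<^sup>2) = t *\<^sub>R P z + w"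
      using curve_reaches[OF t w] .
    define d where "d = 1 + norm b"
    have d: "d \<ge> 1" by (simp add: d_def)
    have e_nonneg: "e \<ge> 0" using e(1) by linarith
    obtain D where D: "\<And>r. r > 0 \<Longrightarrow> (slope (z - b) b has_real_derivative D r) (at r)"
      "\<And>r. r > 0 \<Longrightarrow> D r \<le> - (4 * (norm b)\<^sup>2 / r +
        (\<kappa> - 1) * inner (g (curve (z - b) b r)) (curve (z - b) b r)) / (4 * r\<^sup>2)"
      using slope_deriv[OF _ b(1), of _ "z - b"] by metis
    have c1: "curve (z - b) b 1 = z" by (simp add: curve_def)
    have s1: "slope (z - b) b 1 = inner (dL z) (z - 2 *\<^sub>R b) / 2"
      by (simp add: slope_def curve'_def c1)
    have near: "1/2 \<le> s \<and> s \<le> 3/2" if "\<bar>s - 1\<bar> \<le> \<eta> / d" for s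
    proof -
      have "\<eta> / d \<le> \<eta> / 1" using d \<eta> by (intro divide_left_mono) auto
      then show ?thesis using that \<eta>(2) by (simp add: abs_le_iff)
    qed
    have "L (curve (z - b) b (t\<^sup>2)) \<le> L (curve (z - b) b 1) + (e * d)\<^sup>2 / (2 * (\<delta> * d\<^sup>2))"
    proof (rule concave_almost_maximum[where I = "{0<..}" and c = 1 and \<delta> = "\<delta> * d\<^sup>2"
        and f = "\<lambda>r. L (curve (z - b) b r)" and A = "e * d" and f'' = D and \<eta> = "\<eta> / d" and f' = "slope (z - b) b"])
      show "\<And>s. \<bar>s - 1\<bar> \<le> \<eta> / d \<Longrightarrow> s \<in> {0<..}" using near by fastforce
      show "t\<^sup>2 \<in> {0<..}" using t by simp
      show "\<And>s. s \<in> {0<..} \<Longrightarrow> ((\<lambda>r. L (curve (z - b) b r)) has_real_derivative slope (z - b) b s) (at s)"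
        using L_curve_deriv by simp
      show "\<And>s. s \<in> {0<..} \<Longrightarrow> (slope (z - b) b has_real_derivative D s) (at s)"
        using D(1) by simp
      show "D s \<le> 0" if s: "s \<in> {0<..}" for s
      proof -
        have "0 \<le> (\<kappa> - 1) * inner (g (curve (z - b) b s)) (curve (z - b) b s)"
          using \<kappa> q_nonneg by simp
        moreover have "0 \<le> 4 * (norm b)\<^sup>2 / s" using s by simp
        ultimately have "- (4 * (norm b)\<^sup>2 / s +
          (\<kappa> - 1) * inner (g (curve (z - b) b s)) (curve (z - b) b s)) / (4 * s\<^sup>2) \<le> 0"
          by (intro divide_nonpos_nonneg) auto
        then show ?thesis using D(2)[of s] s by simp
      qed
      show "D s \<le> - (\<delta> * d\<^sup>2)" if s: "\<bar>s - 1\<bar> \<le> \<eta> / d" for s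
      proof -
        define q where "q = inner (g (curve (z - b) b s)) (curve (z - b) b s)"
        have s': "1/2 \<le> s" "s \<le> 3/2" using near[OF s] by auto
        have "norm (curve (z - b) b s - z) \<le> \<bar>s - 1\<bar> * (norm z + 3 * norm b)"
          by (rule curve_displacement) (use s' in \<open>simp only: abs_le_iff, linarith\<close>)
        also have "\<dots> \<le> (\<eta> / d) * ((R + 3) * d)"
        proof (rule mult_mono[OF s])
          have "R * 1 \<le> R * d" using R d by (intro mult_left_mono) auto
          then show "norm z + 3 * norm b \<le> (R + 3) * d"
            using z(1) by (simp add: algebra_simps) (simp add: d_def)
        qed (use \<eta> d in auto)
        also have "\<dots> = \<eta> * (R + 3)" using d by simp
        finally have "q \<ge> inner (g z) z - c / 2"
          unfolding q_def using \<eta>\<zeta> by (intro \<zeta>(2)[OF z(1)]) simp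
        then have q: "q \<ge> c" using q_lower[of z] z(2) e(1,3) e0(2) by linarith
        have "(norm b)\<^sup>2 * 2 \<le> 4 * (norm b)\<^sup>2 / s"
          using s' mult_right_mono[of s 2 "(norm b)\<^sup>2"] by (simp add: field_simps)
        moreover have "(\<kappa> - 1) * c \<le> (\<kappa> - 1) * q" using q \<kappa> by (intro mult_left_mono) auto
        moreover have "32 * \<delta> * (norm b)\<^sup>2 \<le> 2 * (norm b)\<^sup>2"
          using \<delta>(2) by (intro mult_right_mono) auto
        ultimately have "32 * \<delta> * (1 + (norm b)\<^sup>2) \<le> 4 * (norm b)\<^sup>2 / s + (\<kappa> - 1) * q"
          using \<delta>(3) by (simp add: distrib_left)
        moreover have "16 * \<delta> * d\<^sup>2 \<le> 32 * \<delta> * (1 + (norm b)\<^sup>2)"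
        proof -
          have "d\<^sup>2 \<le> 2 * (1 + (norm b)\<^sup>2)"
            unfolding d_def using zero_le_power2[of "1 - norm b"] by (simp add: power2_sum power2_diff)
          then have "16 * \<delta> * d\<^sup>2 \<le> 16 * \<delta> * (2 * (1 + (norm b)\<^sup>2))"
            using \<delta>(1) by (intro mult_left_mono) auto
          then show ?thesis by (simp add: algebra_simps)
        qed
        ultimately have A: "16 * \<delta> * d\<^sup>2 \<le> 4 * (norm b)\<^sup>2 / s + (\<kappa> - 1) * q" by linarith
        have A0: "0 \<le> 4 * (norm b)\<^sup>2 / s + (\<kappa> - 1) * q"
        proof (rule order_trans[OF _ A])
          show "0 \<le> 16 * \<delta> * d\<^sup>2" using \<delta>(1) by simp
        qed
        have "s\<^sup>2 \<le> (3/2)\<^sup>2" using s' by (intro power_mono) auto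
        then have s16: "4 * s\<^sup>2 \<le> 16" by (simp add: power2_eq_square)
        have s0: "4 * s\<^sup>2 > 0" using s' by simp
        have "16 * \<delta> * d\<^sup>2 / 16 \<le> (4 * (norm b)\<^sup>2 / s + (\<kappa> - 1) * q) / (4 * s\<^sup>2)"
          by (rule frac_le[OF A0 A s0 s16])
        moreover have "D s \<le> - ((4 * (norm b)\<^sup>2 / s + (\<kappa> - 1) * q) / (4 * s\<^sup>2))"
          using D(2)[of s] s'(1) unfolding q_def minus_divide_left by simp
        ultimately show ?thesis by linarith
      qed
      show "\<bar>slope (z - b) b 1\<bar> \<le> e * d"
      proof -
        have "\<bar>inner (dL z) (z - 2 *\<^sub>R b)\<bar> \<le> \<bar>inner (dL z) z\<bar> + 2 * \<bar>inner (dL z) b\<bar>"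
          by (simp add: inner_diff_right)
        also have "\<dots> \<le> e + 2 * (e * norm b)" using e(1) e(2)[OF b(1)] by simp
        also have "\<dots> \<le> 2 * (e * d)" using e_nonneg by (simp add: d_def algebra_simps)
        finally show ?thesis by (simp add: s1)
      qed
      show "e * d \<le> \<delta> * d\<^sup>2 * (\<eta> / d) / 2"
      proof -
        have "\<delta> * d\<^sup>2 * (\<eta> / d) / 2 = (\<delta> * \<eta> / 2) * d" using d by (simp add: power2_eq_square)
        moreover have "e * d \<le> (\<delta> * \<eta> / 2) * d" using e(3) e0(3) d by (intro mult_right_mono) auto
        ultimately show ?thesis by simp
      qed
      show "0 < \<delta> * d\<^sup>2" using \<delta> d by simp
      show "0 < \<eta> / d" using \<eta> d by simp
    qed (simp add: is_interval_oi)
    moreover have "(e * d)\<^sup>2 / (2 * (\<delta> * d\<^sup>2)) = 1 / (2 * \<delta>) * e\<^sup>2"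
      using d by (simp add: power_mult_distrib)
    ultimately show "L (t *\<^sub>R P z + w) \<le> L z + 1 / (2 * \<delta>) * e\<^sup>2"
      unfolding b(2) c1 by simp
  qed (use e0 \<delta> in auto)
qed

text \<open>
  The targets with \<open>t = 1\<close>, which no curve reaches, follow by continuity.
\<close>

lemma almost_maximal:
  assumes R: "R \<ge> 0" and c: "c > 0"
  obtains e0 C where "e0 > 0" "C \<ge> 0"
    "\<And>z e t w. norm z \<le> R \<Longrightarrow> L z \<ge> c \<Longrightarrow> \<bar>inner (dL z) z\<bar> \<le> e \<Longrightarrow>
       (\<And>y. y \<in> Y \<Longrightarrow> \<bar>inner (dL z) y\<bar> \<le> e * norm y) \<Longrightarrow> e \<le> e0 \<Longrightarrow>
       t > 0 \<Longrightarrow> w \<in> Y \<Longrightarrow> L (t *\<^sub>R P z + w) \<le> L z + C * e\<^sup>2"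
proof -
  obtain e0 C where eC: "e0 > 0" "C \<ge> 0"
    "\<And>z e t w. norm z \<le> R \<Longrightarrow> L z \<ge> c \<Longrightarrow> \<bar>inner (dL z) z\<bar> \<le> e \<Longrightarrow>
       (\<And>y. y \<in> Y \<Longrightarrow> \<bar>inner (dL z) y\<bar> \<le> e * norm y) \<Longrightarrow> e \<le> e0 \<Longrightarrow>
       t > 0 \<Longrightarrow> t \<noteq> 1 \<Longrightarrow> w \<in> Y \<Longrightarrow> L (t *\<^sub>R P z + w) \<le> L z + C * e\<^sup>2"
    using almost_maximal_off_ray[OF R c] by metis
  have "L (t *\<^sub>R P z + w) \<le> L z + C * e\<^sup>2"
    if z: "norm z \<le> R" "L z \<ge> c" and e: "\<bar>inner (dL z) z\<bar> \<le> e"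
      "\<And>y. y \<in> Y \<Longrightarrow> \<bar>inner (dL z) y\<bar> \<le> e * norm y" "e \<le> e0"
      and t: "t > 0" and w: "w \<in> Y" for z e t w
  proof (cases "t = 1")
    case False
    then show ?thesis using eC(3)[OF z e t False w] by blast
  next
    case True
    have lim: "(\<lambda>n. 1 + 1 / real (Suc n)) \<longlonglongrightarrow> 1 + 0"
      by (intro tendsto_intros LIMSEQ_Suc[OF lim_1_over_n])
    have "(\<lambda>n. (1 + 1 / real (Suc n)) *\<^sub>R P z + w) \<longlonglongrightarrow> (1 + 0) *\<^sub>R P z + w"
      by (intro tendsto_add tendsto_scaleR lim tendsto_const)
    then have "(\<lambda>n. L ((1 + 1 / real (Suc n)) *\<^sub>R P z + w)) \<longlonglongrightarrow> L ((1 + 0) *\<^sub>R P z + w)"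
      using continuous_on_tendsto_compose[OF continuous_L] by simp
    moreover have "L ((1 + 1 / real (Suc n)) *\<^sub>R P z + w) \<le> L z + C * e\<^sup>2" for n
      by (rule eC(3)[OF z e]) (use w in \<open>auto simp: add_pos_pos\<close>)
    ultimately show ?thesis using True by (simp add: LIMSEQ_le_const2)
  qed
  with eC(1,2) that show thesis by blast
qed

subsection \<open>The min-max value\<close>

lemma minmax_le:
  assumes "x \<in> X" "x \<noteq> 0" "\<And>t w. t > 0 \<Longrightarrow> w \<in> Y \<Longrightarrow> L (t *\<^sub>R x + w) \<le> m"
  shows "minmax X Y L \<le> ereal m"
proof -
  have "reduced Y L (t *\<^sub>R x) \<le> m" if "t > 0" for t
    using assms(1) X that maximizer(1)[of "t *\<^sub>R x"]
    by (auto simp: reduced_def subspace_scale intro: assms(3))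
  then have "(SUP t\<in>{0<..}. ereal (reduced Y L (t *\<^sub>R x))) \<le> ereal m"
    by (intro SUP_least) simp
  then show ?thesis
    unfolding minmax_def using assms(1,2) by (intro INF_lower2[of x]) auto
qed

lemma P_nonzero:
  assumes "L z > 0" shows "P z \<noteq> 0"
proof
  assume "P z = 0"
  then have "L z = - (norm (Q z))\<^sup>2 / 2 - \<Psi> z" by (simp add: energy_def)
  then show False using assms Psi_nonneg[of z] zero_le_power2[of "norm (Q z)"] by linarith
qed

text \<open>
  By H2 the function \<open>s \<mapsto> \<Psi> (s v) / s^p\<close> is nondecreasing for \<open>s > 0\<close>.
\<close>

lemma Psi_contraction:
  assumes t: "0 < t" "t \<le> 1"
  shows "\<Psi> (t *\<^sub>R v) \<le> t powr p * \<Psi> v"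
proof -
  define k where "k s = \<Psi> (s *\<^sub>R v) * s powr (- p)" for s
  have der: "\<exists>y. (k has_real_derivative y) (at s) \<and> y \<ge> 0" if s: "t \<le> s" "s \<le> 1" for s
  proof -
    have s0: "s > 0" using s t by simp
    have "((\<lambda>t::real. \<Psi> (t *\<^sub>R v)) has_derivative (\<lambda>t. inner (t *\<^sub>R v) (g (s *\<^sub>R v)))) (at s)"
      by (rule has_derivative_compose[OF _ Psi_deriv]) (auto intro!: derivative_eq_intros)
    then have d1: "((\<lambda>t::real. \<Psi> (t *\<^sub>R v)) has_real_derivative inner v (g (s *\<^sub>R v))) (at s)"
      by (simp add: has_field_derivative_def mult_commute_abs)
    have d2: "((\<lambda>s. s powr (- p)) has_real_derivative - p * s powr (- p - 1)) (at s)"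
      using s0 by (auto intro!: derivative_eq_intros)
    have "(k has_real_derivative inner v (g (s *\<^sub>R v)) * s powr (- p) +
        - p * s powr (- p - 1) * \<Psi> (s *\<^sub>R v)) (at s)"
      unfolding k_def[abs_def] by (rule DERIV_mult[OF d1 d2])
    moreover have "s powr (- p) = s * s powr (- p - 1)"
      using s0 by (simp add: powr_diff)
    then have "inner v (g (s *\<^sub>R v)) * s powr (- p) + - p * s powr (- p - 1) * \<Psi> (s *\<^sub>R v)
      = s powr (- p - 1) * (inner (g (s *\<^sub>R v)) (s *\<^sub>R v) - p * \<Psi> (s *\<^sub>R v))"
      by (simp add: inner_commute algebra_simps)
    moreover have "\<dots> \<ge> 0" using superquadratic[of "s *\<^sub>R v"] by simp
    ultimately show ?thesis by metis
  qed
  have "k t \<le> k 1" using DERIV_nonneg_imp_nondecreasing[OF t(2), of k] der by blast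
  then show ?thesis
    using t by (simp add: k_def powr_minus field_simps)
qed

text \<open>
  Since \<open>p > 2\<close>, on a small sphere of \<open>X\<close> the quadratic part dominates \<open>\<Psi>\<close>.
\<close>

lemma reduced_uniformly_positive:
  obtains \<alpha> where "\<alpha> > 0" "\<And>x. x \<in> X \<Longrightarrow> x \<noteq> 0 \<Longrightarrow> \<exists>t>0. reduced Y L (t *\<^sub>R x) \<ge> \<alpha>"
proof -
  obtain M where M: "M \<ge> 0" "\<And>z w. norm z \<le> 1 \<Longrightarrow> norm w \<le> 1 \<Longrightarrow> norm (g z - g w) \<le> M * norm (z - w)"
    using g_lipschitz by blast
  have Psi_M: "\<Psi> v \<le> M" if "norm v = 1" for v
  proof -
    have "norm (g v) \<le> M" using M(2)[of v 0] that by (simp add: g_0)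
    then have "inner (g v) v \<le> M" using norm_cauchy_schwarz[of "g v" v] that by simp
    then have "p * \<Psi> v \<le> M" using superquadratic[of v] by simp
    moreover have "1 * \<Psi> v \<le> p * \<Psi> v" using p Psi_nonneg by (intro mult_right_mono) auto
    ultimately show ?thesis by simp
  qed
  \<comment> \<open>The radius t solves t^(p - 2) = a, so that M t^p \<le> t^2 / 4.\<close>
  define a where "a = 1 / (4 * (M + 1))"
  have a: "0 < a" "a \<le> 1" "M * a \<le> 1 / 4" using M(1) by (auto simp: a_def field_simps)
  define t where "t = a powr (1 / (p - 2))"
  have t: "0 < t" "t \<le> 1" using a p by (auto simp: t_def powr_le1)
  have ta: "t powr (p - 2) = a" using a p by (simp add: t_def powr_powr)
  have "\<exists>s>0. reduced Y L (s *\<^sub>R x) \<ge> t\<^sup>2 / 4" if x: "x \<in> X" "x \<noteq> 0" for x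
  proof (intro exI conjI)
    define v where "v = (1 / norm x) *\<^sub>R x"
    have v: "norm v = 1" "v \<in> X" using x X by (auto simp: v_def subspace_scale)
    show "t / norm x > 0" using t x by simp
    have "t powr p = t powr (p - 2) * t powr 2" using powr_add[of t "p - 2" 2] by simp
    then have tp: "t powr p = a * t\<^sup>2" using t ta by (simp add: powr_numeral)
    have "\<Psi> (t *\<^sub>R v) \<le> t powr p * M"
      using Psi_contraction[OF t, of v] mult_left_mono[OF Psi_M[OF v(1)], of "t powr p"] by simp
    also have "\<dots> = (M * a) * t\<^sup>2" by (simp add: tp)
    also have "\<dots> \<le> 1 / 4 * t\<^sup>2" using a(3) by (intro mult_right_mono) auto
    finally have "\<Psi> (t *\<^sub>R v) \<le> t\<^sup>2 / 4" by simp
    moreover have "L (t *\<^sub>R v + 0) = t\<^sup>2 / 2 - \<Psi> (t *\<^sub>R v)"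
      using L_add[of "t *\<^sub>R v" 0] v X Y by (simp add: subspace_scale subspace_0 power_mult_distrib)
    moreover have "L (t *\<^sub>R v + 0) \<le> reduced Y L (t *\<^sub>R v)"
      using v X Y by (intro reduced_ge) (auto simp: subspace_scale subspace_0)
    ultimately have "reduced Y L (t *\<^sub>R v) \<ge> t\<^sup>2 / 4" by linarith
    then show "reduced Y L ((t / norm x) *\<^sub>R x) \<ge> t\<^sup>2 / 4" by (simp add: v_def)
  qed
  then show thesis using that[of "t\<^sup>2 / 4"] t by simp
qed

lemma minmax_pos: "minmax X Y L > 0"
proof -
  obtain \<alpha> where \<alpha>: "\<alpha> > 0" "\<And>x. x \<in> X \<Longrightarrow> x \<noteq> 0 \<Longrightarrow> \<exists>t>0. reduced Y L (t *\<^sub>R x) \<ge> \<alpha>"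
    using reduced_uniformly_positive by blast
  have "ereal \<alpha> \<le> minmax X Y L"
    unfolding minmax_def
  proof (rule INF_greatest)
    fix x assume "x \<in> X - {0}"
    then obtain t where "t > 0" "reduced Y L (t *\<^sub>R x) \<ge> \<alpha>" using \<alpha>(2) by blast
    then show "ereal \<alpha> \<le> (SUP t\<in>{0<..}. ereal (reduced Y L (t *\<^sub>R x)))"
      by (intro SUP_upper2[of t]) auto
  qed
  then show ?thesis using \<alpha>(1) by (metis ereal_less(2) order_less_le_trans)
qed

text \<open>
  An energy bound and an almost vanishing gradient give \<open>\<langle>g z, z\<rangle> = O(1 + |z|)\<close>, while
  \<open>|z|\<close> differs from \<open>|g z|\<close> by at most one. Inserting this into H4 yields
  \<open>(1 - \<mu>) |z| = O((1 + |z|)^\<mu>)\<close>, and \<open>\<mu> < 1\<close>.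
\<close>

lemma almost_critical_bounded:
  obtains R where "R \<ge> 0" "\<And>z. L z \<le> m \<Longrightarrow> norm (dL z) \<le> 1 \<Longrightarrow> norm z \<le> R"
proof -
  define a where "a = 1/2 - 1/p"
  have a: "a > 0" using p by (simp add: a_def field_simps)
  define B where "B = (\<bar>m\<bar> + 1/2) / a"
  have B: "B > 0" using a by (simp add: B_def)
  define A where "A = (2 + K * B powr \<mu>) / (1 - \<mu>)"
  have A: "A > 0" using K \<mu> by (simp add: A_def add_pos_nonneg)
  have "norm z \<le> A powr (1 / (1 - \<mu>))" if z: "L z \<le> m" "norm (dL z) \<le> 1" for z
  proof -
    define u where "u = 1 + norm z"
    have u: "u \<ge> 1" by (simp add: u_def)
    have "\<bar>inner (dL z) z\<bar> \<le> norm (dL z) * norm z" by (rule Cauchy_Schwarz_ineq2)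
    also have "\<dots> \<le> 1 * norm z" using z(2) by (intro mult_right_mono) auto
    finally have "- inner (dL z) z \<le> norm z" by simp
    then have "a * inner (g z) z \<le> \<bar>m\<bar> + norm z / 2"
      using q_bound[of z] z(1) unfolding a_def by linarith
    also have "\<dots> \<le> (\<bar>m\<bar> + 1/2) * u"
    proof -
      have "\<bar>m\<bar> * 1 \<le> \<bar>m\<bar> * u" using u by (intro mult_left_mono) auto
      moreover have "(\<bar>m\<bar> + 1/2) * u = \<bar>m\<bar> * u + u / 2" by (simp add: distrib_right)
      moreover have "norm z / 2 \<le> u / 2" by (simp add: u_def)
      ultimately show ?thesis by linarith
    qed
    finally have q: "inner (g z) z \<le> B * u" using a by (simp add: B_def field_simps)
    have "S z = dL z + g z" by (simp add: dL_def)
    then have "norm z \<le> norm (dL z) + norm (g z)" by (metis norm_S norm_triangle_ineq)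
    also have "norm (g z) \<le> K * (inner (g z) z) powr \<mu> + \<mu> * norm z" by (rule growth)
    also have "(inner (g z) z) powr \<mu> \<le> (B * u) powr \<mu>"
      using q q_nonneg \<mu> by (intro powr_mono2) auto
    also have "(B * u) powr \<mu> = B powr \<mu> * u powr \<mu>" using B u by (simp add: powr_mult)
    finally have "norm z \<le> 1 + (K * (B powr \<mu> * u powr \<mu>) + \<mu> * norm z)"
      using z(2) K by simp
    then have "(1 - \<mu>) * u \<le> 2 + K * B powr \<mu> * u powr \<mu>"
      using \<mu> by (simp add: u_def algebra_simps)
    also have "\<dots> \<le> (2 + K * B powr \<mu>) * u powr \<mu>"
      using u \<mu> by (simp add: algebra_simps ge_one_powr_ge_zero)
    also have "\<dots> = (1 - \<mu>) * (A * u powr \<mu>)" using \<mu> by (simp add: A_def)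
    finally have "u \<le> A * u powr \<mu>" using \<mu> by simp
    moreover have "u = u powr (1 - \<mu>) * u powr \<mu>" using u by (simp flip: powr_add)
    ultimately have "u powr (1 - \<mu>) * u powr \<mu> \<le> A * u powr \<mu>" by simp
    moreover have "u powr \<mu> > 0" using u by simp
    ultimately have "u powr (1 - \<mu>) \<le> A" by (simp add: mult_le_cancel_right)
    then have "(u powr (1 - \<mu>)) powr (1 / (1 - \<mu>)) \<le> A powr (1 / (1 - \<mu>))"
      using \<mu> by (intro powr_mono2) auto
    moreover have "(u powr (1 - \<mu>)) powr (1 / (1 - \<mu>)) = u" using u \<mu> by (simp add: powr_powr)
    ultimately show ?thesis by (simp add: u_def)
  qed
  then show thesis using that[of "A powr (1 / (1 - \<mu>))"] by simp
qed

text \<open>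
  The points in question have norm at most some \<open>R\<close>, so \<open>almost_maximal\<close> applies with
  \<open>e = |\<nabla>L(z)| (R + 1)\<close>.
\<close>

lemma minmax_le_almost_critical:
  assumes c: "c1 > 0"
  obtains \<epsilon> C where "\<epsilon> > 0"
    "\<And>z. c1 \<le> L z \<Longrightarrow> L z \<le> c2 \<Longrightarrow> norm (dL z) \<le> \<epsilon> \<Longrightarrow>
       minmax X Y L \<le> ereal (L z + C * (norm (dL z))\<^sup>2)"
proof -
  obtain R where R: "R \<ge> 0" "\<And>z. L z \<le> c2 \<Longrightarrow> norm (dL z) \<le> 1 \<Longrightarrow> norm z \<le> R"
    using almost_critical_bounded by blast
  obtain e0 C where eC: "e0 > 0" "C \<ge> 0"
    "\<And>z e t w. norm z \<le> R \<Longrightarrow> L z \<ge> c1 \<Longrightarrow> \<bar>inner (dL z) z\<bar> \<le> e \<Longrightarrow>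
       (\<And>y. y \<in> Y \<Longrightarrow> \<bar>inner (dL z) y\<bar> \<le> e * norm y) \<Longrightarrow> e \<le> e0 \<Longrightarrow>
       t > 0 \<Longrightarrow> w \<in> Y \<Longrightarrow> L (t *\<^sub>R P z + w) \<le> L z + C * e\<^sup>2"
    using almost_maximal[OF R(1) c] by metis
  show thesis
  proof (rule that[of "min 1 (e0 / (R + 1))" "C * (R + 1)\<^sup>2"])
    show "min 1 (e0 / (R + 1)) > 0" using eC(1) R(1) by simp
    fix z assume z: "c1 \<le> L z" "L z \<le> c2" "norm (dL z) \<le> min 1 (e0 / (R + 1))"
    define e where "e = norm (dL z) * (R + 1)"
    have zR: "norm z \<le> R" using R(2) z by simp
    have "norm (dL z) * norm z \<le> e" unfolding e_def using zR by (intro mult_left_mono) auto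
    then have e1: "\<bar>inner (dL z) z\<bar> \<le> e" using Cauchy_Schwarz_ineq2 order_trans by blast
    have e2: "\<bar>inner (dL z) y\<bar> \<le> e * norm y" for y
    proof -
      have "norm (dL z) * 1 \<le> e" unfolding e_def using R(1) by (intro mult_left_mono) auto
      then have "norm (dL z) * norm y \<le> e * norm y" by (intro mult_right_mono) auto
      then show ?thesis using Cauchy_Schwarz_ineq2 order_trans by blast
    qed
    have "e \<le> e0 / (R + 1) * (R + 1)" unfolding e_def using z(3) R(1) by (intro mult_right_mono) auto
    then have e3: "e \<le> e0" using R(1) by simp
    have "minmax X Y L \<le> ereal (L z + C * e\<^sup>2)"
    proof (rule minmax_le)
      show "P z \<noteq> 0" using P_nonzero z(1) c by simp
      show "L (t *\<^sub>R P z + w) \<le> L z + C * e\<^sup>2" if "t > 0" "w \<in> Y" for t w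
        by (rule eC(3)[OF zR z(1) e1 e2 e3 that])
    qed simp
    then show "minmax X Y L \<le> ereal (L z + C * (R + 1)\<^sup>2 * (norm (dL z))\<^sup>2)"
      by (simp add: e_def power_mult_distrib mult_ac)
  qed
qed

subsection \<open>Almost maximizers on half spaces stay bounded\<close>

text \<open>
  Let \<open>z = x + w\<close> maximize \<open>L\<close> on \<open>x + Y\<close> and let \<open>D\<close> be its radial derivative \<open>\<langle>\<nabla>L(z), z\<rangle>\<close>.
  If \<open>D\<close> were positive, then concavity along the curves leading to \<open>t x\<close> with
  \<open>t \<rightarrow> 0\<close>, where \<open>L\<close> vanishes, would give \<open>D / 2 \<le> L z \<le> m\<close>, hence a bound on \<open>\<langle>g z, z\<rangle>\<close>. Testing
  \<open>\<nabla>L(z) = S z - g z\<close> with \<open>S z\<close>, on which it equals \<open>D\<close> because it annihilates \<open>Y\<close>, shows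
  that \<open>|g z|\<close> is at least \<open>|z|\<close> up to a constant, and H4 with \<open>\<mu> < 1\<close> bounds \<open>|z|\<close>.
\<close>

lemma slope_nonpos_far_out:
  obtains T where "T \<ge> 1"
    "\<And>x w. x \<in> X \<Longrightarrow> w \<in> Y \<Longrightarrow> norm x \<ge> T \<Longrightarrow> L (x + w) \<le> m \<Longrightarrow>
       (\<And>v. v \<in> Y \<Longrightarrow> inner (dL (x + w)) v = 0) \<Longrightarrow> inner (dL (x + w)) (x + w) \<le> 0"
proof -
  define q0 where "q0 = m / (1/2 - 1/p)"
  define T where "T = max 1 ((2 * m + K * q0 powr \<mu>) / (1 - \<mu>) + 1)"
  have "inner (dL (x + w)) (x + w) \<le> 0"
    if x: "x \<in> X" "norm x \<ge> T" and w: "w \<in> Y" and m: "L (x + w) \<le> m"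
      and crit: "\<And>v. v \<in> Y \<Longrightarrow> inner (dL (x + w)) v = 0" for x w
  proof (rule ccontr)
    define z where "z = x + w"
    define D where "D = inner (dL z) z"
    assume "\<not> ?thesis"
    then have D: "D > 0" by (simp add: D_def z_def)
    have Pz: "P z = x" using proj_add[OF x(1) w] by (simp add: z_def)
    have low: "L (t *\<^sub>R x) \<le> L z + D / 2 * (t\<^sup>2 - 1)" if t: "t > 0" "t \<noteq> 1" for t
    proof -
      obtain b where b: "b \<in> Y" "curve (z - b) b (t\<^sup>2) = t *\<^sub>R P z + 0"
        using curve_reaches[OF t subspace_0[OF Y(1)]] by metis
      have "L (curve (z - b) b (t\<^sup>2)) \<le> L z + inner (dL z) (z - 2 *\<^sub>R b) / 2 * (t\<^sup>2 - 1)"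
        using t by (intro L_concave_along_curve b) auto
      moreover have "inner (dL z) (z - 2 *\<^sub>R b) = D"
        using crit[OF b(1)] by (simp add: D_def inner_diff_right z_def)
      ultimately show ?thesis using b(2) Pz by simp
    qed
    have DL: "D / 2 \<le> L z"
    proof -
      have t: "(\<lambda>n. 1 / real (Suc (Suc n))) \<longlonglongrightarrow> 0"
        by (intro LIMSEQ_Suc lim_1_over_n)
      then have "(\<lambda>n. (1 / real (Suc (Suc n))) *\<^sub>R x) \<longlonglongrightarrow> 0 *\<^sub>R x"
        by (intro tendsto_scaleR tendsto_const)
      then have "(\<lambda>n. L ((1 / real (Suc (Suc n))) *\<^sub>R x)) \<longlonglongrightarrow> L (0 *\<^sub>R x)"
        using continuous_on_tendsto_compose[OF continuous_L] by simp
      moreover have "(\<lambda>n. L z + D / 2 * ((1 / real (Suc (Suc n)))\<^sup>2 - 1)) \<longlonglongrightarrow> L z + D / 2 * (0\<^sup>2 - 1)"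
        by (intro tendsto_add tendsto_mult tendsto_const tendsto_diff tendsto_power t)
      moreover have "L ((1 / real (Suc (Suc n))) *\<^sub>R x) \<le> L z + D / 2 * ((1 / real (Suc (Suc n)))\<^sup>2 - 1)" for n
        by (rule low) auto
      ultimately have "L (0 *\<^sub>R x) \<le> L z + D / 2 * (0\<^sup>2 - 1)"
        by (intro LIMSEQ_le) auto
      then show ?thesis by (simp add: L_0)
    qed
    have Lm: "L z \<le> m" using m by (simp add: z_def)
    have p0: "1/2 - 1/p > 0" using p by (simp add: field_simps)
    have "(1/2 - 1/p) * inner (g z) z \<le> m"
      using q_bound[of z] Lm D by (simp add: D_def)
    then have q: "inner (g z) z \<le> q0" using p0 by (simp add: q0_def field_simps)
    have nx: "norm x \<le> norm z"
    proof -
      have "(norm x)\<^sup>2 \<le> (norm z)\<^sup>2" using norm_add_sq(1)[OF x(1) w] by (simp add: z_def)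
      then show ?thesis by (rule power2_le_imp_le) simp
    qed
    then have z1: "norm z \<ge> 1" using x(2) by (simp add: T_def)
    have Sz: "S z = x - w" using S_add[OF x(1) w] by (simp add: z_def)
    have "inner (dL z) w = 0" using crit[OF w] by (simp only: z_def)
    moreover have "D = inner (dL z) x + inner (dL z) w"
      by (simp only: D_def inner_add_right[symmetric] z_def[symmetric])
    moreover have "inner (dL z) (S z) = inner (dL z) x - inner (dL z) w"
      by (simp only: Sz inner_diff_right)
    ultimately have "inner (dL z) (S z) = D" by simp
    then have "inner (S z) (S z) = D + inner (g z) (S z)"
      by (simp add: dL_def inner_diff_left)
    then have "norm z * norm z = D + inner (g z) (S z)"
      by (simp flip: power2_norm_eq_inner power2_eq_square)
    also have "\<dots> \<le> 2 * m * norm z + norm (g z) * norm z"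
    proof (rule add_mono)
      have "D \<le> 2 * m * 1" using DL Lm by simp
      also have "\<dots> \<le> 2 * m * norm z" using D DL Lm z1 by (intro mult_left_mono) auto
      finally show "D \<le> 2 * m * norm z" .
      show "inner (g z) (S z) \<le> norm (g z) * norm z"
        using norm_cauchy_schwarz[of "g z" "S z"] by simp
    qed
    also have "\<dots> = (2 * m + norm (g z)) * norm z" by (simp add: distrib_right)
    finally have "norm z \<le> 2 * m + norm (g z)" by (rule mult_right_le_imp_le) (use z1 in linarith)
    also have "norm (g z) \<le> K * (inner (g z) z) powr \<mu> + \<mu> * norm z" by (rule growth)
    also have "(inner (g z) z) powr \<mu> \<le> q0 powr \<mu>"
      using q q_nonneg \<mu> by (intro powr_mono2) auto
    finally have "norm z \<le> 2 * m + (K * q0 powr \<mu> + \<mu> * norm z)" using K by simp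
    then have "(1 - \<mu>) * norm z \<le> 2 * m + K * q0 powr \<mu>" by (simp add: left_diff_distrib)
    then have "norm z \<le> (2 * m + K * q0 powr \<mu>) / (1 - \<mu>)"
      using \<mu> by (simp add: field_simps)
    then show False using nx x(2) by (simp add: T_def)
  qed
  moreover have "T \<ge> 1" by (simp add: T_def)
  ultimately show thesis using that[of T] by blast
qed

text \<open>
  Beyond norm \<open>T\<close> the reduced functional no longer increases along rays: by concavity it stays below
  its tangent at norm \<open>T\<close>, whose slope is not positive.
\<close>

lemma near_maximum_within_bounded_set:
  obtains T where "T \<ge> 1"
    "\<And>x s. x \<in> X \<Longrightarrow> x \<noteq> 0 \<Longrightarrow> (\<And>t w. t > 0 \<Longrightarrow> w \<in> Y \<Longrightarrow> L (t *\<^sub>R x + w) \<le> m) \<Longrightarrow> s > 0 \<Longrightarrow>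
       \<exists>t>0. t * norm x \<le> T \<and> reduced Y L (s *\<^sub>R x) \<le> reduced Y L (t *\<^sub>R x)"
proof -
  obtain T where T: "T \<ge> 1"
    "\<And>x w. x \<in> X \<Longrightarrow> w \<in> Y \<Longrightarrow> norm x \<ge> T \<Longrightarrow> L (x + w) \<le> m \<Longrightarrow>
       (\<And>v. v \<in> Y \<Longrightarrow> inner (dL (x + w)) v = 0) \<Longrightarrow> inner (dL (x + w)) (x + w) \<le> 0"
    using slope_nonpos_far_out by metis
  have "\<exists>t>0. t * norm x \<le> T \<and> reduced Y L (s *\<^sub>R x) \<le> reduced Y L (t *\<^sub>R x)"
    if x: "x \<in> X" "x \<noteq> 0" "\<And>t w. t > 0 \<Longrightarrow> w \<in> Y \<Longrightarrow> L (t *\<^sub>R x + w) \<le> m" and s: "s > 0" for x s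
  proof (cases "s * norm x \<le> T")
    case True
    then show ?thesis using s by blast
  next
    case False
    define t where "t = T / norm x"
    have t: "t > 0" "t * norm x = T" using T(1) x(2) by (auto simp: t_def)
    have tX: "t *\<^sub>R x \<in> X" "s *\<^sub>R x \<in> X" using x(1) X by (auto simp: subspace_scale)
    obtain w where w: "w \<in> Y" "reduced Y L (t *\<^sub>R x) = L (t *\<^sub>R x + w)"
      "\<And>v. v \<in> Y \<Longrightarrow> inner (dL (t *\<^sub>R x + w)) v = 0"
      using reduced_attained[OF tX(1)] by blast
    obtain v where v: "v \<in> Y" "reduced Y L (s *\<^sub>R x) = L (s *\<^sub>R x + v)"
      using reduced_attained[OF tX(2)] by blast
    define z where "z = t *\<^sub>R x + w"
    have D: "inner (dL z) z \<le> 0"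
      unfolding z_def using T(2)[OF tX(1) w(1) _ x(3)[OF t(1) w(1)] w(3)] t by simp
    define r where "r = s / t"
    have "t * norm x < s * norm x" using False t(2) by simp
    then have r: "r > 1" "r * t = s" using t(1) x(2) by (auto simp: r_def)
    obtain b where b: "b \<in> Y" "curve (z - b) b (r\<^sup>2) = r *\<^sub>R P z + v"
      using curve_reaches[of r v z] r(1) v(1) by auto
    have "P z = t *\<^sub>R x" using proj_add(1)[OF tX(1) w(1)] by (simp add: z_def)
    then have "L (s *\<^sub>R x + v) = L (curve (z - b) b (r\<^sup>2))" using b(2) r(2) by simp
    also have "\<dots> \<le> L z + inner (dL z) (z - 2 *\<^sub>R b) / 2 * (r\<^sup>2 - 1)"
      using r(1) by (intro L_concave_along_curve b) auto
    also have "inner (dL z) (z - 2 *\<^sub>R b) = inner (dL z) z"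
      using w(3)[OF b(1)] by (simp add: inner_diff_right z_def)
    also have "L z + inner (dL z) z / 2 * (r\<^sup>2 - 1) \<le> L z"
      using D r(1) by (simp add: mult_nonpos_nonneg)
    finally have "reduced Y L (s *\<^sub>R x) \<le> reduced Y L (t *\<^sub>R x)" by (simp add: v(2) w(2) z_def)
    then show ?thesis using t by auto
  qed
  with T(1) that show thesis by blast
qed

subsection \<open>A Palais--Smale sequence at the min-max level\<close>

text \<open>
  On the half space of a nearly optimal direction, maximizing over \<open>Y\<close> exactly and over the ray up
  to \<open>\<delta>\<close> gives a point at which \<open>\<nabla>L\<close> annihilates \<open>Y\<close> and which is nearly maximal on its ray.
  The bound \<open>R\<close> is uniform because the energies stay below \<open>c + 1\<close>.
\<close>

lemma near_minmax_point:
  assumes c: "minmax X Y L = ereal c"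
  obtains R where "R \<ge> 0"
    "\<And>\<delta>. 0 < \<delta> \<Longrightarrow> \<delta> \<le> 1 \<Longrightarrow> \<delta> < c \<Longrightarrow> \<exists>z. norm z \<le> R \<and> \<bar>L z - c\<bar> \<le> \<delta> \<and>
       (\<forall>y\<in>Y. inner (dL z) y = 0) \<and> (\<forall>t>0. L (t *\<^sub>R z) \<le> L z + 2 * \<delta>)"
proof -
  obtain T where T: "T \<ge> 1"
    "\<And>x s. x \<in> X \<Longrightarrow> x \<noteq> 0 \<Longrightarrow> (\<And>t w. t > 0 \<Longrightarrow> w \<in> Y \<Longrightarrow> L (t *\<^sub>R x + w) \<le> c + 1) \<Longrightarrow> s > 0 \<Longrightarrow>
       \<exists>t>0. t * norm x \<le> T \<and> reduced Y L (s *\<^sub>R x) \<le> reduced Y L (t *\<^sub>R x)"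
    using near_maximum_within_bounded_set[of "c + 1"] by metis
  have "\<exists>z. norm z \<le> 2 * T \<and> \<bar>L z - c\<bar> \<le> \<delta> \<and>
       (\<forall>y\<in>Y. inner (dL z) y = 0) \<and> (\<forall>t>0. L (t *\<^sub>R z) \<le> L z + 2 * \<delta>)"
    if \<delta>: "0 < \<delta>" "\<delta> \<le> 1" "\<delta> < c" for \<delta>
  proof -
    have "minmax X Y L < ereal (c + \<delta>)" using c \<delta> by simp
    then obtain x where x: "x \<in> X" "x \<noteq> 0"
      and "(SUP t\<in>{0<..}. ereal (reduced Y L (t *\<^sub>R x))) < ereal (c + \<delta>)"
      unfolding minmax_def by (auto simp: INF_less_iff)
    then have red: "reduced Y L (t *\<^sub>R x) < c + \<delta>" if "t > 0" for t
      using SUP_lessD[of "\<lambda>t. ereal (reduced Y L (t *\<^sub>R x))" "{0<..}" "ereal (c + \<delta>)" t] that by auto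
    have tX: "t *\<^sub>R x \<in> X" for t using x(1) X by (simp add: subspace_scale)
    have up: "L (t *\<^sub>R x + w) \<le> c + \<delta>" if "t > 0" "w \<in> Y" for t w
      using reduced_ge[OF tX that(2), of t] red[OF that(1)] by simp
    have "ereal (c - \<delta>) < minmax X Y L" using c \<delta> by simp
    also have "\<dots> \<le> (SUP t\<in>{0<..}. ereal (reduced Y L (t *\<^sub>R x)))"
      unfolding minmax_def using x by (intro INF_lower) auto
    finally obtain s where s: "s > 0" "reduced Y L (s *\<^sub>R x) > c - \<delta>"
      by (auto simp: less_SUP_iff)
    have "L (t *\<^sub>R x + w) \<le> c + 1" if "t > 0" "w \<in> Y" for t w
      using up[OF that] \<delta>(2) by simp
    then obtain t where t: "t > 0" "t * norm x \<le> T" "reduced Y L (s *\<^sub>R x) \<le> reduced Y L (t *\<^sub>R x)"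
      using T(2)[OF x _ s(1)] by blast
    obtain w where w: "w \<in> Y" "reduced Y L (t *\<^sub>R x) = L (t *\<^sub>R x + w)"
      "\<And>v. v \<in> Y \<Longrightarrow> inner (dL (t *\<^sub>R x + w)) v = 0"
      using reduced_attained[OF tX] by blast
    define z where "z = t *\<^sub>R x + w"
    have Lz: "c - \<delta> < L z" "L z \<le> c + \<delta>"
      using s(2) t(3) w(2) up[OF t(1) w(1)] by (auto simp: z_def)
    have "norm w \<le> norm (t *\<^sub>R x)"
    proof -
      have "0 < ((norm (t *\<^sub>R x))\<^sup>2 - (norm w)\<^sup>2) / 2 - \<Psi> z"
        using Lz(1) \<delta>(3) L_add[OF tX w(1), of t] unfolding z_def by linarith
      then have "(norm w)\<^sup>2 \<le> (norm (t *\<^sub>R x))\<^sup>2" using Psi_nonneg[of z] by argo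
      then show ?thesis by (rule power2_le_imp_le) simp
    qed
    then have "norm z \<le> 2 * T"
      using norm_triangle_ineq[of "t *\<^sub>R x" w] t(1,2) by (simp add: z_def)
    moreover have "L (r *\<^sub>R z) \<le> L z + 2 * \<delta>" if "r > 0" for r
    proof -
      have "L ((r * t) *\<^sub>R x + r *\<^sub>R w) \<le> c + \<delta>"
        using that t(1) w(1) Y by (intro up) (auto simp: subspace_scale)
      then show ?thesis using Lz(1) by (simp add: z_def scaleR_add_right)
    qed
    ultimately show ?thesis
      using Lz w(3) by (intro exI[of _ z]) (auto simp: z_def[symmetric] abs_le_iff)
  qed
  then show thesis using that[of "2 * T"] T(1) by simp
qed

text \<open>
  A gradient step of length \<open>s\<close> from a nearly optimal point \<open>z\<close> lowers the energy by about
  \<open>s |\<nabla>L(z)|^2\<close> and changes the gradient on the span of \<open>z\<close> and \<open>Y\<close> by \<open>O(s)\<close> only. By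
  \<open>almost_maximal\<close> the energy of the new point is not below the min-max level by more than
  \<open>O(s^2)\<close>, so the decrease is \<open>O(s^2)\<close> as well.
\<close>

lemma almost_critical_at_minmax:
  assumes c: "minmax X Y L = ereal c"
  obtains s0 F where "s0 > 0"
    "\<And>s. 0 < s \<Longrightarrow> s \<le> s0 \<Longrightarrow> \<exists>z. \<bar>L z - c\<bar> \<le> s\<^sup>2 \<and> (norm (dL z))\<^sup>2 \<le> F * s"
proof -
  have c0: "c > 0" using minmax_pos c by simp
  obtain R where R: "R \<ge> 0"
    "\<And>\<delta>. 0 < \<delta> \<Longrightarrow> \<delta> \<le> 1 \<Longrightarrow> \<delta> < c \<Longrightarrow> \<exists>z. norm z \<le> R \<and> \<bar>L z - c\<bar> \<le> \<delta> \<and>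
       (\<forall>y\<in>Y. inner (dL z) y = 0) \<and> (\<forall>t>0. L (t *\<^sub>R z) \<le> L z + 2 * \<delta>)"
    using near_minmax_point[OF c] by metis
  obtain M0 where M0: "M0 \<ge> 0"
    "\<And>z w. norm z \<le> R \<Longrightarrow> norm w \<le> R \<Longrightarrow> norm (dL z - dL w) \<le> M0 * norm (z - w)"
    using dL_lipschitz by blast
  define B where "B = M0 * R"
  have B: "B \<ge> 0" using M0 R by (simp add: B_def)
  have GB: "norm (dL z) \<le> B" if "norm z \<le> R" for z
    using M0(2)[OF that, of 0] R(1) mult_left_mono[OF that M0(1)] by (simp add: dL_0 B_def)
  \<comment> \<open>A ball containing both the points (1 + h) z with |h| \<le> 1/2 and the displaced points z - s G.\<close>
  define R1 where "R1 = 2 * R + B"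
  have R1: "R1 \<ge> 0" "2 * R \<le> R1" "R + B \<le> R1" using R B by (auto simp: R1_def)
  obtain M where M: "M \<ge> 0"
    "\<And>z w. norm z \<le> R1 \<Longrightarrow> norm w \<le> R1 \<Longrightarrow> norm (dL z - dL w) \<le> M * norm (z - w)"
    using dL_lipschitz by blast
  obtain e0 C where eC: "e0 > 0" "C \<ge> 0"
    "\<And>z e t w. norm z \<le> R1 \<Longrightarrow> L z \<ge> c / 2 \<Longrightarrow> \<bar>inner (dL z) z\<bar> \<le> e \<Longrightarrow>
       (\<And>y. y \<in> Y \<Longrightarrow> \<bar>inner (dL z) y\<bar> \<le> e * norm y) \<Longrightarrow> e \<le> e0 \<Longrightarrow>
       t > 0 \<Longrightarrow> w \<in> Y \<Longrightarrow> L (t *\<^sub>R P z + w) \<le> L z + C * e\<^sup>2"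
    using almost_maximal[OF R1(1), of "c / 2"] c0 by (metis half_gt_zero)
  \<comment> \<open>The gradient at the displaced point is at most E s on the span of that point and Y.\<close>
  define E where "E = 2 + M * R\<^sup>2 + M * B * R1 + B\<^sup>2 + M * B"
  have E: "E > 0" "M * B \<le> E" "2 + M * R\<^sup>2 + M * B * R1 + B\<^sup>2 \<le> E"
    using M(1) B R1(1) by (auto simp: E_def intro!: add_pos_nonneg)
  \<comment> \<open>The energy at the displaced point is at least c - s A.\<close>
  define A where "A = 1 + B\<^sup>2 + M * B\<^sup>2"
  have A: "A \<ge> 1" using M(1) by (simp add: A_def)
  define s0 where "s0 = min (min (1/2) (c / (2 * A))) (e0 / E)"
  have s0: "s0 > 0" "s0 \<le> 1/2" "s0 * A \<le> c / 2" "E * s0 \<le> e0"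
  proof -
    show "s0 > 0" using c0 A eC(1) E by (simp add: s0_def)
    show "s0 \<le> 1/2" unfolding s0_def by (rule min.coboundedI1, rule min.cobounded1)
    have "s0 * A \<le> c / (2 * A) * A" using A by (intro mult_right_mono) (auto simp: s0_def)
    then show "s0 * A \<le> c / 2" using A by simp
    have "E * s0 \<le> E * (e0 / E)" using E by (intro mult_left_mono) (auto simp: s0_def)
    then show "E * s0 \<le> e0" using E by simp
  qed
  have "\<exists>z. \<bar>L z - c\<bar> \<le> s\<^sup>2 \<and> (norm (dL z))\<^sup>2 \<le> (1 + M * B\<^sup>2 + C * E\<^sup>2) * s"
    if s: "0 < s" "s \<le> s0" for s
  proof -
    have s1: "s \<le> 1/2" using s s0 by simp
    have ss: "s\<^sup>2 \<le> s" using s s1 by (simp add: power2_eq_square mult_le_cancel_right1)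
    have "s * 1 \<le> s * A" using A s by (intro mult_left_mono) auto
    also have "\<dots> \<le> s0 * A" using A s by (intro mult_right_mono) auto
    finally have sA: "s \<le> c / 2" "s * A \<le> c / 2"
      using s0(3) mult_right_mono[OF s(2), of A] A by linarith+
    obtain z where z: "norm z \<le> R" "\<bar>L z - c\<bar> \<le> s\<^sup>2" "\<And>y. y \<in> Y \<Longrightarrow> inner (dL z) y = 0"
      "\<And>t. t > 0 \<Longrightarrow> L (t *\<^sub>R z) \<le> L z + 2 * s\<^sup>2"
      using R(2)[of "s\<^sup>2"] s s1 ss sA c0 by auto
    have zR1: "norm z \<le> R1" using z(1) R1 R(1) by simp
    define G where "G = dL z"
    have G: "norm G \<le> B" using GB[OF z(1)] by (simp add: G_def)
    have G2: "(norm G)\<^sup>2 \<le> B\<^sup>2" using G by (intro power_mono) auto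
    \<comment> \<open>Near-maximality on the ray through z, tested at the points (1 + s) z and (1 - s) z,
      bounds the radial derivative by O(s).\<close>
    have ray: "h * inner G z \<le> (2 + M * R\<^sup>2) * s\<^sup>2" if h: "\<bar>h\<bar> = s" for h
    proof -
      have "norm (z + h *\<^sub>R z) \<le> norm z + s * norm z"
        using norm_triangle_ineq[of z "h *\<^sub>R z"] h by simp
      also have "\<dots> \<le> norm z + 1 * norm z" using s1 by (intro add_left_mono mult_right_mono) auto
      finally have "norm (z + h *\<^sub>R z) \<le> R1" using z(1) R1(2) by simp
      then have "\<bar>L (z + h *\<^sub>R z) - L z - inner (dL z) (h *\<^sub>R z)\<bar> \<le> M * (norm (h *\<^sub>R z))\<^sup>2"
        using L_taylor[of M R1 z "h *\<^sub>R z"] M zR1 by blast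
      moreover have "L (z + h *\<^sub>R z) \<le> L z + 2 * s\<^sup>2"
      proof -
        have "1 + h > 0" using h s1 by linarith
        from z(4)[OF this] show ?thesis by (simp add: scaleR_add_left)
      qed
      ultimately have "h * inner G z \<le> 2 * s\<^sup>2 + M * (s\<^sup>2 * (norm z)\<^sup>2)"
        using h by (simp add: G_def power_mult_distrib)
      also have "M * (s\<^sup>2 * (norm z)\<^sup>2) \<le> M * (s\<^sup>2 * R\<^sup>2)"
        using M(1) z(1) by (intro mult_left_mono power_mono) auto
      finally show ?thesis by (simp add: algebra_simps)
    qed
    have D: "\<bar>inner G z\<bar> \<le> (2 + M * R\<^sup>2) * s"
    proof -
      have "s * \<bar>inner G z\<bar> \<le> (2 + M * R\<^sup>2) * s\<^sup>2"
        using ray[of s] ray[of "- s"] s by (cases "inner G z \<ge> 0") auto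
      then have "s * \<bar>inner G z\<bar> \<le> s * ((2 + M * R\<^sup>2) * s)" by (simp add: power2_eq_square mult_ac)
      then show ?thesis using s(1) by simp
    qed
    define z' where "z' = z + (- s) *\<^sub>R G"
    have dist: "norm (z' - z) \<le> s * B" using s G by (simp add: z'_def mult_left_mono)
    have "norm z' \<le> norm z + norm (z' - z)" using norm_triangle_ineq[of z "z' - z"] by simp
    also have "\<dots> \<le> R + 1 * B" using z(1) dist s1 B mult_right_mono[of s 1 B] by linarith
    finally have z'R1: "norm z' \<le> R1" using R1 by simp
    have tay: "\<bar>L z' - L z + s * (norm G)\<^sup>2\<bar> \<le> M * (s\<^sup>2 * (norm G)\<^sup>2)"
      using L_taylor[of M R1 z "(- s) *\<^sub>R G"] M zR1 z'R1
      by (simp add: z'_def G_def power_mult_distrib power2_norm_eq_inner)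
    have tay2: "M * (s\<^sup>2 * (norm G)\<^sup>2) \<le> M * (s\<^sup>2 * B\<^sup>2)"
      using M(1) G2 by (intro mult_left_mono) auto
    have Lz': "L z' \<ge> c / 2"
    proof -
      have "M * (s\<^sup>2 * B\<^sup>2) \<le> M * (s * B\<^sup>2)" using M(1) ss by (intro mult_left_mono mult_right_mono) auto
      moreover have "s * (norm G)\<^sup>2 \<le> s * B\<^sup>2" using s G2 by (intro mult_left_mono) auto
      moreover have "s * A = s + s * B\<^sup>2 + M * (s * B\<^sup>2)" by (simp add: A_def algebra_simps)
      ultimately show ?thesis using tay tay2 z(2) ss sA(2) by linarith
    qed
    have lip: "norm (dL z' - G) \<le> M * (s * B)"
      using M(2)[OF z'R1 zR1] mult_left_mono[OF dist M(1)] by (simp add: G_def)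
    have e1: "\<bar>inner (dL z') z'\<bar> \<le> E * s"
    proof -
      have "inner (dL z') z' = inner G z + inner (dL z' - G) z' + inner G (z' - z)"
        by (simp add: inner_diff_left inner_diff_right)
      moreover have "\<bar>inner (dL z' - G) z'\<bar> \<le> M * (s * B) * R1"
      proof -
        have "norm (dL z' - G) * norm z' \<le> M * (s * B) * R1"
          using lip z'R1 M(1) s B by (intro mult_mono) auto
        then show ?thesis using Cauchy_Schwarz_ineq2 order_trans by blast
      qed
      moreover have "\<bar>inner G (z' - z)\<bar> \<le> B * (s * B)"
      proof -
        have "norm G * norm (z' - z) \<le> B * (s * B)"
          using G dist B by (intro mult_mono) auto
        then show ?thesis using Cauchy_Schwarz_ineq2 order_trans by blast
      qed
      ultimately have "\<bar>inner (dL z') z'\<bar> \<le> (2 + M * R\<^sup>2) * s + M * (s * B) * R1 + B * (s * B)"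
        using D by linarith
      also have "\<dots> = (2 + M * R\<^sup>2 + M * B * R1 + B\<^sup>2) * s" by (simp add: algebra_simps power2_eq_square)
      also have "\<dots> \<le> E * s" using E(3) s by (intro mult_right_mono) auto
      finally show ?thesis .
    qed
    have e2: "\<bar>inner (dL z') y\<bar> \<le> E * s * norm y" if "y \<in> Y" for y
    proof -
      have "inner (dL z') y = inner (dL z' - G) y" using z(3)[OF that] by (simp add: inner_diff_left G_def)
      moreover have "M * (s * B) \<le> E * s" using E(2) s mult_right_mono[of "M * B" E s] by (simp add: mult_ac)
      then have "norm (dL z' - G) * norm y \<le> E * s * norm y"
        using lip by (intro mult_right_mono) auto
      ultimately show ?thesis using Cauchy_Schwarz_ineq2[of "dL z' - G" y] by simp
    qed
    have "E * s \<le> E * s0" using s E(1) by (intro mult_left_mono) auto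
    then have e3: "E * s \<le> e0" using s0(4) by simp
    have "minmax X Y L \<le> ereal (L z' + C * (E * s)\<^sup>2)"
    proof (rule minmax_le)
      show "P z' \<noteq> 0" using P_nonzero Lz' c0 by simp
      show "L (t *\<^sub>R P z' + w) \<le> L z' + C * (E * s)\<^sup>2" if "t > 0" "w \<in> Y" for t w
        by (rule eC(3)[OF z'R1 Lz' e1 e2 e3 that])
    qed simp
    then have "c \<le> L z' + C * (E * s)\<^sup>2" using c by simp
    then have "s * (norm G)\<^sup>2 \<le> s\<^sup>2 + M * (s\<^sup>2 * B\<^sup>2) + C * (E * s)\<^sup>2"
      using tay tay2 z(2) by linarith
    also have "\<dots> = s * ((1 + M * B\<^sup>2 + C * E\<^sup>2) * s)"
      by (simp add: algebra_simps power2_eq_square)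
    finally have "(norm G)\<^sup>2 \<le> (1 + M * B\<^sup>2 + C * E\<^sup>2) * s" using s(1) by simp
    then show ?thesis using z(2) unfolding G_def by blast
  qed
  then show thesis using that[OF s0(1)] by blast
qed

text \<open>
  The limit of the subsequence is not the origin, since \<open>L\<close> vanishes there and the min-max value is
  positive.
\<close>

lemma palais_smale_critical_point:
  assumes c: "minmax X Y L = ereal c" and PS: "palais_smale_at L (ereal c)"
  shows "\<exists>v. v \<noteq> 0 \<and> L v = c \<and> dL v = 0"
proof -
  obtain s0 F where F: "s0 > 0"
    "\<And>s. 0 < s \<Longrightarrow> s \<le> s0 \<Longrightarrow> \<exists>z. \<bar>L z - c\<bar> \<le> s\<^sup>2 \<and> (norm (dL z))\<^sup>2 \<le> F * s"
    using almost_critical_at_minmax[OF c] by metis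
  define s where "s n = s0 / real (Suc n)" for n
  have s: "0 < s n" "s n \<le> s0" for n
    using F(1) by (auto simp: s_def divide_le_eq mult_le_cancel_left1)
  have s_lim: "s \<longlonglongrightarrow> 0"
  proof -
    have "(\<lambda>n. s0 * (1 / real (Suc n))) \<longlonglongrightarrow> s0 * 0"
      by (rule tendsto_mult[OF tendsto_const LIMSEQ_Suc[OF lim_1_over_n]])
    then show ?thesis by (simp add: s_def[abs_def])
  qed
  obtain u where u: "\<And>n. \<bar>L (u n) - c\<bar> \<le> (s n)\<^sup>2" "\<And>n. (norm (dL (u n)))\<^sup>2 \<le> F * s n"
    using F(2)[OF s] by metis
  have "(\<lambda>n. (s n)\<^sup>2) \<longlonglongrightarrow> 0\<^sup>2" by (intro tendsto_power s_lim)
  then have s2: "(\<lambda>n. (s n)\<^sup>2) \<longlonglongrightarrow> 0" by simp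
  have "(\<lambda>n. L (u n) - c) \<longlonglongrightarrow> 0"
    by (rule Lim_null_comparison[OF _ s2]) (simp add: u(1))
  then have Lu: "(\<lambda>n. L (u n)) \<longlonglongrightarrow> c" by (rule LIM_zero_cancel)
  have "(\<lambda>n. F * s n) \<longlonglongrightarrow> F * 0" by (intro tendsto_mult s_lim tendsto_const)
  then have Fs: "(\<lambda>n. F * s n) \<longlonglongrightarrow> 0" by simp
  have "(\<lambda>n. (norm (dL (u n)))\<^sup>2) \<longlonglongrightarrow> 0"
    by (rule Lim_null_comparison[OF _ Fs]) (simp add: u(2))
  then have "(\<lambda>n. sqrt ((norm (dL (u n)))\<^sup>2)) \<longlonglongrightarrow> sqrt 0" by (rule tendsto_real_sqrt)
  then have dLu: "(\<lambda>n. dL (u n)) \<longlonglongrightarrow> 0" by (simp add: tendsto_norm_zero_iff)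
  obtain r l where r: "strict_mono r" "(u \<circ> r) \<longlonglongrightarrow> l"
    using PS Lu dLu unfolding palais_smale_at_def grad_L by (metis tendsto_ereal)
  have "(\<lambda>n. L ((u \<circ> r) n)) \<longlonglongrightarrow> L l"
    using continuous_on_tendsto_compose[OF continuous_L r(2)] by simp
  moreover have "(\<lambda>n. L ((u \<circ> r) n)) \<longlonglongrightarrow> c"
    using LIMSEQ_subseq_LIMSEQ[OF Lu r(1)] by (simp add: o_def)
  ultimately have "L l = c" by (rule LIMSEQ_unique)
  have "(\<lambda>n. dL ((u \<circ> r) n)) \<longlonglongrightarrow> dL l"
    using continuous_on_tendsto_compose[OF continuous_dL r(2)] by simp
  moreover have "(\<lambda>n. dL ((u \<circ> r) n)) \<longlonglongrightarrow> 0"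
    using LIMSEQ_subseq_LIMSEQ[OF dLu r(1)] by (simp add: o_def)
  ultimately have "dL l = 0" by (rule LIMSEQ_unique)
  moreover have "l \<noteq> 0"
    using \<open>L l = c\<close> minmax_pos c by (auto simp: L_0)
  ultimately show ?thesis using \<open>L l = c\<close> by blast
qed

end

section \<open>The min-max estimate and the critical point\<close>

theorem theorem2p10:
  fixes X Y :: "'a::{real_inner, banach} set"
    and \<Psi> :: "'a \<Rightarrow> real"
    and \<rho> :: "real \<Rightarrow> real"
    and p K \<mu> \<kappa> c1 c2 :: real
    and z :: "nat \<Rightarrow> 'a"
  defines "L \<equiv> energy X Y \<Psi>"
  defines "\<gamma> \<equiv> minmax X Y L"
  assumes X: "subspace X" "closed X" "infinite_dimensional X"
    and Y: "subspace Y" "closed Y" "infinite_dimensional Y"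
    and orth: "\<And>x y. x \<in> X \<Longrightarrow> y \<in> Y \<Longrightarrow> orthogonal x y"
    and sum: "{x + y |x y. x \<in> X \<and> y \<in> Y} = UNIV"
    and C2: "C2 \<Psi>"
    and H1: "continuous_on {0..} \<rho>" "\<And>s. s \<ge> 0 \<Longrightarrow> \<rho> s \<ge> 0"
      "\<And>v. norm (hess \<Psi> v) \<le> \<rho> (norm v)"
    and H2: "\<Psi> 0 = 0" "p > 2" "\<And>v. inner (grad \<Psi> v) v \<ge> p * \<Psi> v"
    and H3: "\<exists>v. \<Psi> v \<noteq> 0" "convex_on UNIV \<Psi>"
    and H4: "K > 0" "1/2 < \<mu>" "\<mu> < 1"
      "\<And>v. norm (grad \<Psi> v) \<le> K * (inner (grad \<Psi> v) v) powr \<mu> + \<mu> * norm v"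
    and H5: "\<kappa> > 1"
      "\<And>v w. inner (hess \<Psi> v (v + w)) (v + w) - 2 * inner (grad \<Psi> v) w
                \<ge> \<kappa> * inner (grad \<Psi> v) v"
    and seq: "c1 > 0" "c2 > 0" "\<And>n. c1 \<le> L (z n)" "\<And>n. L (z n) \<le> c2"
      "(\<lambda>n. norm (grad L (z n))) \<longlonglongrightarrow> 0"
  shows "\<gamma> > 0 \<and>
     (\<exists>r :: nat \<Rightarrow> real. r \<in> O(\<lambda>n. (norm (grad L (z n)))\<^sup>2) \<and>
        (\<forall>\<^sub>F n in sequentially. \<gamma> \<le> ereal (L (z n) + r n))) \<and>
     (palais_smale_at L \<gamma> \<longrightarrow> (\<exists>v. v \<noteq> 0 \<and> ereal (L v) = \<gamma> \<and> grad L v = 0))"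
proof -
  interpret E: strongly_indefinite X Y \<Psi> "grad \<Psi>" "hess \<Psi>" p K \<mu> \<kappa>
  proof
    show "\<exists>M. \<forall>v. norm v \<le> R \<longrightarrow> norm (hess \<Psi> v) \<le> M" for R
    proof -
      have "continuous_on {0..R} \<rho>" by (rule continuous_on_subset[OF H1(1)]) auto
      then have "compact (\<rho> ` {0..R})" by (rule compact_continuous_image) simp
      then have "bounded (\<rho> ` {0..R})" by (rule compact_imp_bounded)
      then obtain M where M: "\<And>s. s \<in> {0..R} \<Longrightarrow> norm (\<rho> s) \<le> M"
        unfolding bounded_iff by blast
      have "norm (hess \<Psi> v) \<le> M" if "norm v \<le> R" for v
        using H1(3)[of v] M[of "norm v"] that by simp
      then show ?thesis by blast
    qed
    show "x \<in> X \<Longrightarrow> y \<in> Y \<Longrightarrow> orthogonal x y" for x y by (rule orth)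
    show "GDERIV \<Psi> v :> grad \<Psi> v" for v by (rule C2_grad_hess(1)[OF C2])
    show "(grad \<Psi> has_derivative blinfun_apply (hess \<Psi> v)) (at v)" for v
      by (rule C2_grad_hess(2)[OF C2])
  qed (use X Y sum H2 H3 H4 H5 in auto)
  have gradL: "grad L = E.dL" unfolding L_def by (rule E.grad_L)
  obtain \<epsilon> C where C: "\<epsilon> > 0"
    "\<And>v. c1 \<le> L v \<Longrightarrow> L v \<le> c2 \<Longrightarrow> norm (grad L v) \<le> \<epsilon> \<Longrightarrow>
       \<gamma> \<le> ereal (L v + C * (norm (grad L v))\<^sup>2)"
    using E.minmax_le_almost_critical[OF seq(1), of c2] unfolding L_def \<gamma>_def E.grad_L by metis
  have pos: "\<gamma> > 0" unfolding \<gamma>_def L_def by (rule E.minmax_pos)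
  have "\<forall>\<^sub>F n in sequentially. norm (grad L (z n)) < \<epsilon>"
    using order_tendstoD(2)[OF seq(5) C(1)] .
  then have ev: "\<forall>\<^sub>F n in sequentially. \<gamma> \<le> ereal (L (z n) + C * (norm (grad L (z n)))\<^sup>2)"
    by (rule eventually_mono) (intro C(2) seq(3,4) less_imp_le)
  have bigo: "(\<lambda>n. C * (norm (grad L (z n)))\<^sup>2) \<in> O(\<lambda>n. (norm (grad L (z n)))\<^sup>2)"
    by (rule bigoI[of _ "\<bar>C\<bar>"]) (simp add: abs_mult)
  obtain n where "\<gamma> \<le> ereal (L (z n) + C * (norm (grad L (z n)))\<^sup>2)"
    using eventually_happens[OF ev] by auto
  with pos obtain c where c: "\<gamma> = ereal c" by (cases \<gamma>) auto
  have "\<exists>v. v \<noteq> 0 \<and> ereal (L v) = \<gamma> \<and> grad L v = 0" if PS: "palais_smale_at L \<gamma>"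
    using E.palais_smale_critical_point[of c] c PS
    unfolding L_def \<gamma>_def E.grad_L by simp
  with pos ev bigo show ?thesis by blast
qed

end
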